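(* Consider the Gaussian white noise regression model in wavelet form: given $f$, one observes independently $X_{lk}\mid f_{lk}\sim\mathcal N(f_{lk},1/n)$ for $l\ge0$, $k\in\mathcal K_l=\{0,\dots,2^l-1\}$, and write $X^{(n)}=(X_{lk})_{l,k}$. Let $h$ be a probability density on $\mathbb R$ such that: (i) $h$ is symmetric, positive, bounded, and decreasing on $[0,\infty)$; (ii) for some $c_1>0$, $\kappa\ge0$, $\log(1/h(x))\le c_1(1+\log^{1+\kappa}(1+x))$ for all $x\ge0$. Let $\Pi$ be the prior on $f=(f_{lk})$ under which $f_{lk}=s_l\zeta_{lk}$ with $(\zeta_{lk})$ i.i.d. of density $h$ and $s_l=2^{-l^2}$. Consider the multiscale space $\mathcal M_0=\mathcal M_0(w)$ with $w_l=l^{1+\kappa+\varepsilon}$ for $l\ge1$ and $w_0=1$, for some $\varepsilon>0$. Suppose $f_0\in\mathcal H^\beta(L)$ for some $\beta,L>0$. Then, as $n\to\infty$, $$E_{f_0}\,\beta_{\mathcal M_0}\big(\Pi[\cdot\mid X^{(n)}]\circ\tau^{-1},\ \mathcal L(\mathbb W)\big)\to0,$$ where $\tau:f\mapsto\sqrt n(f-X^{(n)})$ and $\mathcal L(\mathbb W)$ is the law of a Gaussian white noise in $\mathcal M_0$. Further, the same result holds when instead $s_l=2^{-l(1/2+\alpha)}$, for any $\alpha>0$, with $w_l=l^{(1+\kappa+\varepsilon)/2}$ for $l\ge1$ and $w_0=1$, for some $\varepsilon>0$.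
   Context: Functions $f\in L^2[0,1]$ are identified with their coefficients $f_{lk}=\langle f,\psi_{lk}\rangle$ on an orthonormal boundary-corrected wavelet basis $\{\psi_{lk}:l\ge0,k\in\mathcal K_l\}$ of $L^2[0,1]$ (the scaling function being denoted as $\psi_{00}$). The Hölder-type ball is $\mathcal H^\beta(L)=\{f=(f_{lk}):\ \max_{k\in\mathcal K_l}|f_{lk}|\le2^{-l(1/2+\beta)}L\ \text{for all } l\ge0\}$. For a monotone weighting sequence $w=(w_l)_{l\ge0}$ with $w_l\ge1$, $\mathcal M(w)=\{x=(x_{lk}):\ \|x\|_{\mathcal M(w)}:=\sup_l\max_k|x_{lk}|/w_l<\infty\}$ and $\mathcal M_0(w)=\{x\in\mathcal M(w):\ \lim_{l\to\infty}\max_k|x_{lk}|/w_l=0\}$, a separable closed subspace, equipped with the same norm. $\mathbb W=(\mathbb W_{lk})_{l,k}$ is a sequence of i.i.d. $\mathcal N(0,1)$ variables (almost surely in $\mathcal M_0(w)$ when $w_l/\sqrt l\to\infty$). For a metric space $S$, $\beta_S(P,Q)$ denotes the bounded-Lipschitz metric between probability distributions on $S$, $\beta_S(P,Q)=\sup\{|\int F\,dP-\int F\,dQ|:\ \|F\|_\infty+\|F\|_{\mathrm{Lip}}\le1\}$. $\Pi[\cdot\mid X^{(n)}]$ is the posterior distribution of $f$: under it the $f_{lk}$ are independent, $f_{lk}$ having density proportional to $\theta\mapsto e^{-n(X_{lk}-\theta)^2/2}h(\theta/s_l)$; $\Pi[\cdot\mid X^{(n)}]\circ\tau^{-1}$ is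 its image under $\tau$. $E_{f_0}$ is the expectation when $X_{lk}\sim\mathcal N(f_{0,lk},1/n)$ independently.
   Formalization: The convergence is proved assuming in addition that h is continuous at f_{0,lk}/s_l for each nonzero f_{0,lk}; conditions (i)-(ii) allow h to jump there, and then the limiting posterior of that coordinate is not Gaussian and the claim fails. *)

theory Defs
  imports "HOL-Probability.Probability"
begin

text \<open>
  A function on \<open>[0,1]\<close> is identified with its wavelet coefficients \<open>f (l, k)\<close>,
  \<open>0 \<le> k < 2 ^ l\<close>. Sequences are functions on \<open>wavelet_idx\<close>, extensional
  outside of it, as in the product space \<open>PiM wavelet_idx (\<lambda>_. borel)\<close>.
\<close>

definition wavelet_idx :: "(nat \<times> nat) set" where
  "wavelet_idx = {(l, k). k < 2 ^ l}"

definition level_max :: "(nat \<times> nat \<Rightarrow> real) \<Rightarrow> nat \<Rightarrow> real" where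
  "level_max x l = (MAX k\<in>{..<2 ^ l}. \<bar>x (l, k)\<bar>)"

definition holder_ball :: "real \<Rightarrow> real \<Rightarrow> (nat \<times> nat \<Rightarrow> real) set" where
  "holder_ball \<beta> L = {f. \<forall>l. level_max f l \<le> 2 powr (- real l * (1/2 + \<beta>)) * L}"


section \<open>Multiscale spaces\<close>

definition M_norm :: "(nat \<Rightarrow> real) \<Rightarrow> (nat \<times> nat \<Rightarrow> real) \<Rightarrow> real" where
  "M_norm w x =
     (if bdd_above (range (\<lambda>l. level_max x l / w l)) then SUP l. level_max x l / w l else 0)"

definition M_space :: "(nat \<Rightarrow> real) \<Rightarrow> (nat \<times> nat \<Rightarrow> real) set" where
  "M_space w = {x \<in> extensional wavelet_idx. bdd_above (range (\<lambda>l. level_max x l / w l))}"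

definition M0_space :: "(nat \<Rightarrow> real) \<Rightarrow> (nat \<times> nat \<Rightarrow> real) set" where
  "M0_space w = {x \<in> M_space w. (\<lambda>l. level_max x l / w l) \<longlonglongrightarrow> 0}"

text \<open>The value 0 of \<^const>\<open>M_norm\<close> outside the space makes \<open>M_dist\<close> nonnegative everywhere, as
  the locale \<^locale>\<open>Metric_space\<close> requires. \<^const>\<open>M_norm\<close> only looks at the coordinates in \<open>wavelet_idx\<close>, so the difference
  need not be made extensional.\<close>

definition M_dist :: "(nat \<Rightarrow> real) \<Rightarrow> (nat \<times> nat \<Rightarrow> real) \<Rightarrow> (nat \<times> nat \<Rightarrow> real) \<Rightarrow> real" where
  "M_dist w x y = M_norm w (\<lambda>i. x i - y i)"

definition borel_M0 :: "(nat \<Rightarrow> real) \<Rightarrow> (nat \<times> nat \<Rightarrow> real) measure" where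
  "borel_M0 w = sigma (M0_space w) {U. openin (Metric_space.mtopology (M0_space w) (M_dist w)) U}"

text \<open>The Borel law on \<open>\<M>\<^sub>0(w)\<close> of a random sequence with distribution \<open>P\<close> on the product space,
  for \<open>P\<close> concentrated on \<open>\<M>\<^sub>0(w)\<close>; the value on the exceptional null set is immaterial.\<close>

definition law_on_M0 ::
  "(nat \<Rightarrow> real) \<Rightarrow> (nat \<times> nat \<Rightarrow> real) measure \<Rightarrow> (nat \<times> nat \<Rightarrow> real) measure" where
  "law_on_M0 w P =
     distr P (borel_M0 w) (\<lambda>x. if x \<in> M0_space w then x else (\<lambda>i\<in>wavelet_idx. 0))"


section \<open>Bounded-Lipschitz metric\<close>

definition sup_norm_on :: "'a set \<Rightarrow> ('a \<Rightarrow> real) \<Rightarrow> ennreal" where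
  "sup_norm_on S F = (SUP x\<in>S. ennreal \<bar>F x\<bar>)"

definition Lip_norm_on :: "'a set \<Rightarrow> ('a \<Rightarrow> 'a \<Rightarrow> real) \<Rightarrow> ('a \<Rightarrow> real) \<Rightarrow> ennreal" where
  "Lip_norm_on S d F =
     (SUP (x, y)\<in>{(x, y). x \<in> S \<and> y \<in> S \<and> x \<noteq> y}. ennreal (\<bar>F x - F y\<bar> / d x y))"

definition BL_dist ::
  "'a set \<Rightarrow> ('a \<Rightarrow> 'a \<Rightarrow> real) \<Rightarrow> 'a measure \<Rightarrow> 'a measure \<Rightarrow> real" where
  "BL_dist S d P Q =
     (SUP F\<in>{F. sup_norm_on S F + Lip_norm_on S d F \<le> 1}. \<bar>(\<integral>x. F x \<partial>P) - (\<integral>x. F x \<partial>Q)\<bar>)"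


section \<open>White noise model, prior and posterior\<close>

definition white_noise :: "(nat \<times> nat \<Rightarrow> real) measure" where
  "white_noise = (\<Pi>\<^sub>M i\<in>wavelet_idx. density lborel (normal_density 0 1))"

definition data_law :: "nat \<Rightarrow> (nat \<times> nat \<Rightarrow> real) \<Rightarrow> (nat \<times> nat \<Rightarrow> real) measure" where
  "data_law n f = (\<Pi>\<^sub>M i\<in>wavelet_idx. density lborel (normal_density (f i) (1 / sqrt (real n))))"

text \<open>Law of \<open>s * \<zeta>\<close> for \<open>\<zeta>\<close> of density \<open>h\<close>.\<close>

definition coord_prior :: "(real \<Rightarrow> real) \<Rightarrow> real \<Rightarrow> real measure" where
  "coord_prior h s = distr (density lborel h) borel (\<lambda>z. s * z)"

definition prior :: "(real \<Rightarrow> real) \<Rightarrow> (nat \<Rightarrow> real) \<Rightarrow> (nat \<times> nat \<Rightarrow> real) measure" where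
  "prior h s = (\<Pi>\<^sub>M i\<in>wavelet_idx. coord_prior h (s (fst i)))"

text \<open>Bayes' formula; the independence of the coordinates under prior and model
  makes the posterior a product. See \<open>coord_posterior_eq\<close> for the Lebesgue density.\<close>

definition coord_posterior :: "nat \<Rightarrow> (real \<Rightarrow> real) \<Rightarrow> real \<Rightarrow> real \<Rightarrow> real measure" where
  "coord_posterior n h s x =
     density (coord_prior h s)
       (\<lambda>\<theta>. ennreal (normal_density \<theta> (1 / sqrt (real n)) x /
               (\<integral>t. normal_density t (1 / sqrt (real n)) x \<partial>coord_prior h s)))"

definition posterior ::
  "nat \<Rightarrow> (real \<Rightarrow> real) \<Rightarrow> (nat \<Rightarrow> real) \<Rightarrow> (nat \<times> nat \<Rightarrow> real) \<Rightarrow> (nat \<times> nat \<Rightarrow> real) measure" where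
  "posterior n h s X = (\<Pi>\<^sub>M i\<in>wavelet_idx. coord_posterior n h (s (fst i)) (X i))"

definition rescale ::
  "nat \<Rightarrow> (nat \<times> nat \<Rightarrow> real) \<Rightarrow> (nat \<times> nat \<Rightarrow> real) \<Rightarrow> (nat \<times> nat \<Rightarrow> real)" where
  "rescale n X f = (\<lambda>i\<in>wavelet_idx. sqrt (real n) * (f i - X i))"

text \<open>The law \<open>\<Pi>[\<cdot> | X] \<circ> \<tau>\<^sup>-\<^sup>1\<close>, on the product space.\<close>

definition rescaled_posterior ::
  "nat \<Rightarrow> (real \<Rightarrow> real) \<Rightarrow> (nat \<Rightarrow> real) \<Rightarrow> (nat \<times> nat \<Rightarrow> real) \<Rightarrow> (nat \<times> nat \<Rightarrow> real) measure" where
  "rescaled_posterior n h s X =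
     distr (posterior n h s X) (\<Pi>\<^sub>M i\<in>wavelet_idx. borel) (rescale n X)"

text \<open>What is implicit in writing the expected bounded-Lipschitz distance: both laws live on
  \<open>\<M>\<^sub>0(w)\<close>, and the distance is an integrable function of the data (the Bochner integral of a
  non-integrable function would be 0).\<close>

definition BvM_well_posed ::
  "(real \<Rightarrow> real) \<Rightarrow> (nat \<Rightarrow> real) \<Rightarrow> (nat \<Rightarrow> real) \<Rightarrow> (nat \<times> nat \<Rightarrow> real) \<Rightarrow> bool" where
  "BvM_well_posed h s w f\<^sub>0 \<longleftrightarrow>
     (AE x in white_noise. x \<in> M0_space w) \<and>
     (\<forall>n\<ge>1. (AE X in data_law n f\<^sub>0. AE x in rescaled_posterior n h s X. x \<in> M0_space w) \<and>
            integrable (data_law n f\<^sub>0)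
              (\<lambda>X. BL_dist (M0_space w) (M_dist w)
                     (law_on_M0 w (rescaled_posterior n h s X)) (law_on_M0 w white_noise)))"

text \<open>Monotonicity of the density \<open>h\<close> on the half-line does not exclude jumps. If \<open>h\<close> jumps at
  \<open>f\<^sub>0 (l, k) / s l \<noteq> 0\<close>, the rescaled posterior of that coordinate has, in the limit, a density
  proportional to the normal density times a two-valued step function, so its bounded-Lipschitz
  distance to the normal law does not vanish. Hence the following condition, which holds in
  particular for continuous \<open>h\<close>. At 0 nothing is needed, since the one-sided limits of a symmetric
  \<open>h\<close> agree there.\<close>

definition cont_at_truth :: "(real \<Rightarrow> real) \<Rightarrow> (nat \<Rightarrow> real) \<Rightarrow> (nat \<times> nat \<Rightarrow> real) \<Rightarrow> bool" where
  "cont_at_truth h s f\<^sub>0 \<longleftrightarrow> (\<forall>(l, k)\<in>wavelet_idx. f\<^sub>0 (l, k) \<noteq> 0 \<longrightarrow> isCont h (f\<^sub>0 (l, k) / s l))"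


section \<open>Consistency of the definitions\<close>

lemma level_max_ge: "k < 2 ^ l \<Longrightarrow> \<bar>x (l, k)\<bar> \<le> level_max x l"
  unfolding level_max_def by (intro Max_ge) auto

lemma level_max_leI: "(\<And>k. k < 2 ^ l \<Longrightarrow> \<bar>x (l, k)\<bar> \<le> c) \<Longrightarrow> level_max x l \<le> c"
  unfolding level_max_def by (subst Max_le_iff) (auto simp: lessThan_empty_iff bot_nat_def)

lemma level_max_nonneg: "0 \<le> level_max x l"
  using level_max_ge[of 0 l x] by simp

lemma level_max_diff_triangle:
  "level_max (\<lambda>i. x i - z i) l \<le> level_max (\<lambda>i. x i - y i) l + level_max (\<lambda>i. y i - z i) l"
proof (rule level_max_leI)
  fix k :: nat assume "k < 2 ^ l"
  from level_max_ge[OF this, of "\<lambda>i. x i - y i"] level_max_ge[OF this, of "\<lambda>i. y i - z i"]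
  show "\<bar>x (l, k) - z (l, k)\<bar> \<le> level_max (\<lambda>i. x i - y i) l + level_max (\<lambda>i. y i - z i) l"
    by linarith
qed

lemma level_max_diff_le: "level_max (\<lambda>i. x i - y i) l \<le> level_max x l + level_max y l"
proof (rule level_max_leI)
  fix k :: nat assume "k < 2 ^ l"
  from level_max_ge[OF this, of x] level_max_ge[OF this, of y]
  show "\<bar>x (l, k) - y (l, k)\<bar> \<le> level_max x l + level_max y l" by linarith
qed

lemma level_max_diff_commute: "level_max (\<lambda>i. x i - y i) l = level_max (\<lambda>i. y i - x i) l"
  by (simp add: level_max_def abs_minus_commute)

lemma bdd_above_diff:
  assumes w: "\<And>l. w l > 0" and x: "x \<in> M_space w" and y: "y \<in> M_space w"
  shows "bdd_above (range (\<lambda>l. level_max (\<lambda>i. x i - y i) l / w l))"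
proof -
  obtain A B where A: "\<And>l. level_max x l / w l \<le> A" and B: "\<And>l. level_max y l / w l \<le> B"
    using x y by (auto simp: M_space_def bdd_above_def)
  have "level_max (\<lambda>i. x i - y i) l / w l \<le> A + B" for l
  proof -
    have "level_max (\<lambda>i. x i - y i) l / w l \<le> (level_max x l + level_max y l) / w l"
      using level_max_diff_le w[of l] by (intro divide_right_mono) auto
    also have "\<dots> \<le> A + B" using A[of l] B[of l] by (simp add: add_divide_distrib)
    finally show ?thesis .
  qed
  then show ?thesis by (auto intro!: bdd_aboveI2)
qed

lemma Metric_space_M_space:
  assumes w: "\<And>l. w l > 0"
  shows "Metric_space (M_space w) (M_dist w)"
proof -
  have le: "level_max (\<lambda>i. x i - y i) l / w l \<le> M_dist w x y"
    if "x \<in> M_space w" "y \<in> M_space w" for x y l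
    using cSUP_upper[OF UNIV_I bdd_above_diff[OF w that], of l] bdd_above_diff[OF w that]
    by (simp add: M_dist_def M_norm_def)
  have ge0: "0 \<le> level_max (\<lambda>i. x i - y i) l / w l" for x y l
    using level_max_nonneg w[of l] by (simp add: less_imp_le)
  have comm: "M_dist w x y = M_dist w y x" for x y
    by (simp add: M_dist_def M_norm_def level_max_diff_commute[of x y])
  have triangle: "M_dist w x z \<le> M_dist w x y + M_dist w y z"
    if "x \<in> M_space w" "y \<in> M_space w" "z \<in> M_space w" for x y z
  proof -
    have "level_max (\<lambda>i. x i - z i) l / w l \<le> M_dist w x y + M_dist w y z" for l
    proof -
      have "level_max (\<lambda>i. x i - z i) l / w l
          \<le> (level_max (\<lambda>i. x i - y i) l + level_max (\<lambda>i. y i - z i) l) / w l"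
        using level_max_diff_triangle w[of l] by (intro divide_right_mono) auto
      also have "\<dots> \<le> M_dist w x y + M_dist w y z"
        using le[of x y l] le[of y z l] that by (simp add: add_divide_distrib)
      finally show ?thesis .
    qed
    moreover have "bdd_above (range (\<lambda>l. level_max (\<lambda>i. x i - z i) l / w l))"
      using bdd_above_diff[OF w that(1,3)] .
    ultimately show ?thesis
      unfolding M_dist_def[of w x z] M_norm_def by (auto intro: cSUP_least)
  qed
  have zero: "M_dist w x y = 0 \<longleftrightarrow> x = y" if "x \<in> M_space w" "y \<in> M_space w" for x y
  proof
    assume 0: "M_dist w x y = 0"
    show "x = y"
    proof (rule extensionalityI[where A = wavelet_idx])
      fix i assume "i \<in> wavelet_idx"
      then obtain l k where i: "i = (l, k)" "k < 2 ^ l" by (auto simp: wavelet_idx_def)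
      have "level_max (\<lambda>i. x i - y i) l \<le> 0"
        using le[OF that, of l] 0 w[of l] by (simp add: divide_le_0_iff)
      then show "x i = y i" using level_max_ge[OF i(2), of "\<lambda>i. x i - y i"] i by simp
    qed (use that in \<open>auto simp: M_space_def\<close>)
  next
    assume "x = y"
    have "level_max (\<lambda>i. y i - y i) l = 0" for l
      using level_max_leI[of l "\<lambda>i. y i - y i" 0] level_max_nonneg[of "\<lambda>i. y i - y i" l] by simp
    with \<open>x = y\<close> show "M_dist w x y = 0" by (simp add: M_dist_def M_norm_def)
  qed
  show ?thesis
  proof
    show "0 \<le> M_dist w x y" for x y
    proof (cases "bdd_above (range (\<lambda>l. level_max (\<lambda>i. x i - y i) l / w l))")
      case True
      from ge0[of x y 0] cSUP_upper[OF UNIV_I True, of 0] True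
      show ?thesis by (simp add: M_dist_def M_norm_def)
    qed (simp add: M_dist_def M_norm_def)
  qed (use comm triangle zero in auto)
qed

lemma Metric_space_M0_space:
  assumes "\<And>l. w l > 0"
  shows "Metric_space (M0_space w) (M_dist w)"
  using Metric_space.subspace[OF Metric_space_M_space[OF assms]] by (auto simp: M0_space_def)

lemma coord_prior_eq:
  assumes [measurable]: "h \<in> borel_measurable borel" and h: "\<And>x. 0 \<le> h x" and s: "s > 0"
  shows "coord_prior h s = density lborel (\<lambda>\<theta>. ennreal (h (\<theta> / s) / s))"
proof -
  have "distr (density lborel h) borel (\<lambda>z. s * z)
      = distr (density lborel (\<lambda>z. ennreal (h ((s * z) / s)))) borel (\<lambda>z. s * z)"
    using s by simp
  also have "\<dots> = density (distr lborel borel (\<lambda>z. s * z)) (\<lambda>\<theta>. ennreal (h (\<theta> / s)))"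
    by (subst density_distr) auto
  also have "distr lborel borel (\<lambda>z. s * z) = density lborel (\<lambda>_. ennreal (inverse s))"
    using lborel_distr_mult[of s] s by simp
  also have "density (density lborel (\<lambda>_. ennreal (inverse s))) (\<lambda>\<theta>. ennreal (h (\<theta> / s)))
      = density lborel (\<lambda>\<theta>. ennreal (h (\<theta> / s) / s))"
    using s h by (subst density_density_eq)
      (auto simp: ennreal_mult[symmetric] divide_inverse mult.commute)
  finally show ?thesis by (simp add: coord_prior_def)
qed

lemma coord_posterior_eq:
  assumes [measurable]: "h \<in> borel_measurable borel" and h: "\<And>x. 0 \<le> h x"
    and s: "s > 0" and n: "n > 0"
  shows "coord_posterior n h s x =
     density lborel (\<lambda>\<theta>. ennreal (exp (- (real n * (x - \<theta>)\<^sup>2) / 2) * h (\<theta> / s) /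
        (\<integral>t. exp (- (real n * (x - t)\<^sup>2) / 2) * h (t / s) \<partial>lborel)))"
proof -
  define c where "c = sqrt (real n / (2 * pi))"
  have c: "c > 0" using n by (simp add: c_def)
  define e where "e = (\<lambda>\<theta>. exp (- (real n * (x - \<theta>)\<^sup>2) / 2))"
  have e: "e \<theta> \<ge> 0" for \<theta> by (simp add: e_def)
  have [measurable]: "e \<in> borel_measurable borel" by (simp add: e_def)
  have nd: "normal_density \<theta> (1 / sqrt (real n)) x = c * e \<theta>" for \<theta>
    using n by (simp add: normal_density_def c_def e_def real_sqrt_divide field_simps)
  define Z where "Z = (\<integral>t. e t * h (t / s) \<partial>lborel)"
  have Z: "(\<integral>t. c * e t \<partial>coord_prior h s) = (c / s) * Z"
    unfolding coord_prior_eq[OF assms(1) h s] Z_def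
    using h s by (subst integral_density) (auto simp flip: integral_mult_right_zero
      intro!: Bochner_Integration.integral_cong)
  have "coord_posterior n h s x
      = density lborel (\<lambda>\<theta>. ennreal (h (\<theta> / s) / s) * ennreal (c * e \<theta> / ((c / s) * Z)))"
    unfolding coord_posterior_def nd Z
    unfolding coord_prior_eq[OF assms(1) h s]
    by (subst density_density_eq) auto
  also have "(\<lambda>\<theta>. ennreal (h (\<theta> / s) / s) * ennreal (c * e \<theta> / ((c / s) * Z)))
      = (\<lambda>\<theta>. ennreal (e \<theta> * h (\<theta> / s) / Z))"
  proof
    fix \<theta>
    have "ennreal (h (\<theta> / s) / s) * ennreal (c * e \<theta> / ((c / s) * Z))
        = ennreal (h (\<theta> / s) / s * (c * e \<theta> / ((c / s) * Z)))"
      using h s by (intro ennreal_mult'[symmetric]) simp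
    also have "h (\<theta> / s) / s * (c * e \<theta> / ((c / s) * Z)) = e \<theta> * h (\<theta> / s) / Z"
      using s c by (simp add: field_simps)
    finally show "ennreal (h (\<theta> / s) / s) * ennreal (c * e \<theta> / ((c / s) * Z))
        = ennreal (e \<theta> * h (\<theta> / s) / Z)" .
  qed
  finally show ?thesis by (simp add: e_def Z_def)
qed

end

theory Submission
  imports Defs
begin

text \<open>
  Write \<open>X = f\<^sub>0 + Z / sqrt n\<close> with \<open>Z\<close> white noise. After rescaling, coordinate \<open>(l, k)\<close> of the
  posterior has density proportional to \<open>\<phi>(u) h((X + u / sqrt n) / s l)\<close>, where \<open>\<phi>\<close> is the standard
  normal density. Bounding \<open>h\<close> above in the numerator, and below by its smallest value on
  \<open>\<bar>u\<bar> \<le> 1\<close> in the normalising constant, gives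
  \<open>P(\<bar>u\<bar> > M) \<le> C exp (- M\<^sup>2 / 4) / h((\<bar>X\<bar> + 1) / s l)\<close>. Almost surely \<open>\<bar>Z (l, k)\<bar> \<le> l + 1\<close> at all
  high levels, and there the tail condition on \<open>h\<close> bounds the last factor by
  \<open>exp (K (l + ln (1 / s l)) powr (1 + \<kappa>))\<close>, uniformly in \<open>n\<close>. Both choices of \<open>(s, w)\<close> make this exponent
  negligible against \<open>(w l)\<^sup>2\<close>, so with \<open>M = \<delta> w l\<close> the tails are summable over all coefficients. By
  Borel--Cantelli the laws live on \<open>\<M>\<^sub>0(w)\<close>, and up to a small error the bounded-Lipschitz distance only
  sees finitely many coordinates; on these the densities converge pointwise, hence in \<open>L\<^sup>1\<close> by
  Scheffe's lemma. So the distance tends to 0 for almost every \<open>Z\<close>, and dominated convergence concludes.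
\<close>

section \<open>Borel structure and Lipschitz functions on the multiscale space\<close>

abbreviation coeff_space :: "(nat \<times> nat \<Rightarrow> real) measure" where
  "coeff_space \<equiv> (\<Pi>\<^sub>M i\<in>wavelet_idx. borel)"

definition truncate :: "nat \<Rightarrow> (nat \<times> nat \<Rightarrow> real) \<Rightarrow> nat \<times> nat \<Rightarrow> real" where
  "truncate J x = (\<lambda>i\<in>wavelet_idx. if fst i < J then x i else 0)"

definition low_idx :: "nat \<Rightarrow> (nat \<times> nat) set" where
  "low_idx J = {i\<in>wavelet_idx. fst i < J}"

lemma low_idx_subset: "low_idx J \<subseteq> wavelet_idx"
  by (auto simp: low_idx_def)

lemma finite_low_idx [simp]: "finite (low_idx J)"
proof (rule finite_subset)
  show "low_idx J \<subseteq> Sigma {..<J} (\<lambda>l. {..<2 ^ l})"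
    by (auto simp: low_idx_def wavelet_idx_def)
qed auto

lemma wavelet_idx_iff [simp]: "(l, k) \<in> wavelet_idx \<longleftrightarrow> k < 2 ^ l"
  by (simp add: wavelet_idx_def)

lemma level_max_le_iff: "level_max x l \<le> c \<longleftrightarrow> (\<forall>k<2 ^ l. \<bar>x (l, k)\<bar> \<le> c)"
  using level_max_ge[of _ l x] level_max_leI[of l x c] by (auto intro: order_trans)

lemma measurable_coeff:
  "i \<in> wavelet_idx \<Longrightarrow> (\<lambda>x. x i) \<in> borel_measurable coeff_space"
  by (rule measurable_component_singleton)

lemma measurable_level_max:
  assumes "\<And>k. k < 2 ^ l \<Longrightarrow> (\<lambda>x. f x (l, k)) \<in> borel_measurable M"
  shows "(\<lambda>x. level_max (f x) l) \<in> borel_measurable M"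
  unfolding level_max_def using assms by (intro borel_measurable_Max) (auto intro!: borel_measurable_abs)

lemma space_coeff_space: "space coeff_space = extensional wavelet_idx"
  by (auto simp: space_PiM PiE_def)

locale weights =
  fixes w :: "nat \<Rightarrow> real"
  assumes w_pos: "w l > 0"
begin

sublocale Metric_space "M0_space w" "M_dist w"
  by (rule Metric_space_M0_space) (rule w_pos)

lemma level_max_ratio_nonneg: "0 \<le> level_max x l / w l"
  using level_max_nonneg w_pos[of l] by (simp add: less_imp_le)

text \<open>A convergent real sequence is bounded, so the limit already forces membership in
  \<open>M_space\<close>.\<close>

lemma M0_space_iff:
  "x \<in> M0_space w \<longleftrightarrow> x \<in> extensional wavelet_idx \<and> (\<lambda>l. level_max x l / w l) \<longlonglongrightarrow> 0"
proof -
  have "bdd_above (range (\<lambda>l. level_max x l / w l))" if "(\<lambda>l. level_max x l / w l) \<longlonglongrightarrow> 0"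
    using convergent_imp_Bseq[OF convergentI[OF that]] by (rule Bseq_bdd_above)
  then show ?thesis by (auto simp: M0_space_def M_space_def)
qed

lemma M_dist_leI: "(\<And>l. level_max (\<lambda>i. x i - y i) l / w l \<le> c) \<Longrightarrow> M_dist w x y \<le> c"
  unfolding M_dist_def M_norm_def by (auto intro!: cSUP_least bdd_aboveI2)

lemma level_max_le_M_dist:
  assumes "x \<in> M0_space w" "y \<in> M0_space w"
  shows "level_max (\<lambda>i. x i - y i) l / w l \<le> M_dist w x y"
proof -
  have "bdd_above (range (\<lambda>l. level_max (\<lambda>i. x i - y i) l / w l))"
    using assms by (intro bdd_above_diff w_pos) (auto simp: M0_space_def)
  then show ?thesis unfolding M_dist_def M_norm_def by (auto intro!: cSUP_upper)
qed

lemma truncate_in_M0 [simp]: "truncate J x \<in> M0_space w"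
proof -
  have "level_max (truncate J x) l = 0" if "l \<ge> J" for l
    using that level_max_nonneg[of "truncate J x" l]
    by (intro antisym level_max_leI) (auto simp: truncate_def)
  then have "\<forall>\<^sub>F l in sequentially. level_max (truncate J x) l / w l = 0"
    by (auto simp: eventually_sequentially)
  then show ?thesis by (auto simp: M0_space_iff tendsto_eventually truncate_def)
qed

lemma zero_in_M0 [simp]: "(\<lambda>i\<in>wavelet_idx. 0) \<in> M0_space w"
  using truncate_in_M0[of 0 undefined] by (simp add: truncate_def)

text \<open>The difference vanishes below level \<open>J\<close> and equals \<open>x\<close> from
  there on. This is how Lipschitz functions are reduced to finitely many coefficients.\<close>

lemma M_dist_truncate_le:
  assumes "\<And>l. l \<ge> J \<Longrightarrow> level_max x l \<le> c * w l" "c \<ge> 0"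
  shows "M_dist w x (truncate J x) \<le> c"
proof (rule M_dist_leI)
  fix l
  have "level_max (\<lambda>i. x i - truncate J x i) l \<le> (if l < J then 0 else level_max x l)"
    by (rule level_max_leI) (auto simp: truncate_def level_max_ge)
  also have "\<dots> \<le> c * w l" using assms(1)[of l] assms(2) w_pos[of l] by auto
  finally show "level_max (\<lambda>i. x i - truncate J x i) l / w l \<le> c"
    using w_pos[of l] by (simp add: field_simps)
qed

section \<open>Separability of the multiscale space\<close>

definition rational_points :: "(nat \<times> nat \<Rightarrow> real) set" where
  "rational_points = (\<Union>J. truncate J ` (PiE (low_idx J) (\<lambda>_. \<rat>)))"

lemma countable_rational_points: "countable rational_points"
  unfolding rational_points_def by (intro countable_UN countable_image countable_PiE countableI_type) (auto simp: countable_rat)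

lemma rational_points_subset: "rational_points \<subseteq> M0_space w"
  by (auto simp: rational_points_def)

text \<open>The decay that defines the space makes the coefficients beyond some level
  \<open>J\<close> negligible relative to the weights; the finitely many remaining ones are replaced
  by nearby rationals.\<close>

lemma rational_points_dense:
  assumes x: "x \<in> M0_space w" and "e > 0"
  shows "\<exists>c\<in>rational_points. M_dist w x c < e"
proof -
  have "(\<lambda>l. level_max x l / w l) \<longlonglongrightarrow> 0" using x by (simp add: M0_space_iff)
  then have "\<forall>\<^sub>F l in sequentially. level_max x l / w l < e / 2"
    using \<open>e > 0\<close> by (intro order_tendstoD) auto
  then obtain J where J: "\<And>l. l \<ge> J \<Longrightarrow> level_max x l / w l < e / 2"
    by (auto simp: eventually_sequentially)
  \<comment> \<open>The error allowed at a coefficient is proportional to the weight of its level,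
    so division by \<open>w l\<close> leaves \<open>e / 2\<close> at every level.\<close>
  have "\<forall>i. \<exists>q\<in>\<rat>. \<bar>x i - q\<bar> \<le> e / 2 * w (fst i)"
  proof
    fix i
    have "x i - e / 2 * w (fst i) < x i" using \<open>e > 0\<close> w_pos[of "fst i"] by simp
    from Rats_dense_in_real[OF this] show "\<exists>q\<in>\<rat>. \<bar>x i - q\<bar> \<le> e / 2 * w (fst i)"
      by (auto intro!: bexI)
  qed
  then obtain q where q: "\<And>i. q i \<in> \<rat>" "\<And>i. \<bar>x i - q i\<bar> \<le> e / 2 * w (fst i)"
    by metis
  have "truncate J q = truncate J (restrict q (low_idx J))"
    by (auto simp: truncate_def low_idx_def fun_eq_iff)
  then have "truncate J q \<in> rational_points"
    using q by (auto simp: rational_points_def intro!: exI[of _ J] imageI)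
  moreover have "M_dist w x (truncate J q) \<le> e / 2"
  proof (rule M_dist_leI)
    fix l
    have "\<bar>x (l, k) - truncate J q (l, k)\<bar> \<le> e / 2 * w l" if "k < 2 ^ l" for k
      using that J[of l] q(2)[of "(l, k)"] level_max_ge[OF that, of x] w_pos[of l]
      by (auto simp: truncate_def field_simps)
    then have "level_max (\<lambda>i. x i - truncate J q i) l \<le> e / 2 * w l"
      by (rule level_max_leI)
    then show "level_max (\<lambda>i. x i - truncate J q i) l / w l \<le> e / 2"
      using w_pos[of l] by (simp add: field_simps)
  qed
  ultimately show ?thesis using \<open>e > 0\<close> by (intro bexI[of _ "truncate J q"]) auto
qed

section \<open>Open sets and the product sigma-algebra\<close>

lemma sets_M0_space: "M0_space w \<in> sets coeff_space"
proof -
  note measurable_level_max [measurable]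
  \<comment> \<open>The reciprocals \<open>1 / (r + 1)\<close> stand in for all positive bounds,
    which leaves only countable quantifiers.\<close>
  have "(\<lambda>l. level_max x l / w l) \<longlonglongrightarrow> 0 \<longleftrightarrow>
      (\<forall>r::nat. \<exists>N. \<forall>l\<ge>N. level_max x l / w l < inverse (real (Suc r)))" for x
  proof
    assume "(\<lambda>l. level_max x l / w l) \<longlonglongrightarrow> 0"
    then have "\<forall>\<^sub>F l in sequentially. level_max x l / w l < inverse (real (Suc r))" for r
      by (intro order_tendstoD) auto
    then show "\<forall>r::nat. \<exists>N. \<forall>l\<ge>N. level_max x l / w l < inverse (real (Suc r))"
      unfolding eventually_sequentially by blast
  next
    assume *: "\<forall>r::nat. \<exists>N. \<forall>l\<ge>N. level_max x l / w l < inverse (real (Suc r))"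
    show "(\<lambda>l. level_max x l / w l) \<longlonglongrightarrow> 0"
    proof (rule LIMSEQ_I)
      fix e :: real assume "e > 0"
      then obtain r where r: "inverse (real (Suc r)) < e" using reals_Archimedean by blast
      obtain N where "\<forall>l\<ge>N. level_max x l / w l < inverse (real (Suc r))" using * by blast
      then have "\<forall>l\<ge>N. norm (level_max x l / w l - 0) < e"
        using r level_max_ratio_nonneg[of x] by (metis abs_of_nonneg diff_zero less_trans real_norm_def)
      then show "\<exists>N. \<forall>l\<ge>N. norm (level_max x l / w l - 0) < e" by blast
    qed
  qed
  then have "M0_space w = {x\<in>space coeff_space. \<forall>r::nat. \<exists>N. \<forall>l\<ge>N. level_max x l / w l < inverse (real (Suc r))}"
    unfolding space_coeff_space using M0_space_iff by blast
  also have "\<dots> \<in> sets coeff_space" by measurable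
  finally show ?thesis .
qed

lemma sets_ball: 
  assumes c: "c \<in> M0_space w"
  shows "mball c r \<in> sets coeff_space"
proof -
  note measurable_level_max [measurable] sets_M0_space [measurable]
  \<comment> \<open>Strict inequality at every level would still permit a supremum equal to
    \<open>r\<close>. A rational strictly below \<open>r\<close> that bounds all levels excludes
    this, and it ranges over a countable set.\<close>
  have "M_dist w c x < r \<longleftrightarrow> (\<exists>q. real_of_rat q < r \<and> (\<forall>l. level_max (\<lambda>i. c i - x i) l / w l \<le> real_of_rat q))"
    if x: "x \<in> M0_space w" for x
  proof
    assume "M_dist w c x < r"
    from of_rat_dense[OF this] obtain q where "M_dist w c x < real_of_rat q" "real_of_rat q < r" by auto
    then show "\<exists>q. real_of_rat q < r \<and> (\<forall>l. level_max (\<lambda>i. c i - x i) l / w l \<le> real_of_rat q)"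
      using level_max_le_M_dist[OF c x] by (meson less_imp_le order_trans)
  qed (auto intro: le_less_trans[OF M_dist_leI])
  then have "mball c r = {x\<in>space coeff_space. x \<in> M0_space w \<and>
      (\<exists>q. real_of_rat q < r \<and> (\<forall>l. level_max (\<lambda>i. c i - x i) l / w l \<le> real_of_rat q))}"
    using c sets.sets_into_space[OF sets_M0_space] by auto
  also have "\<dots> \<in> sets coeff_space" by measurable
  finally show ?thesis .
qed

text \<open>By separability an open set is the union of those balls inside it that have a centre in
  \<open>rational_points\<close> and a rational radius: a countable union of product-measurable
  sets.\<close>

lemma sets_openin:
  assumes U: "openin mtopology U"
  shows "U \<in> sets coeff_space"
proof -
  define \<B> where "\<B> = {mball c (real_of_rat q) | c q. c \<in> rational_points \<and> mball c (real_of_rat q) \<subseteq> U}"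
  have "\<B> \<subseteq> (\<lambda>(c, q). mball c (real_of_rat q)) ` (rational_points \<times> UNIV)"
    by (auto simp: \<B>_def)
  then have "countable \<B>"
    by (rule countable_subset) (intro countable_image countable_SIGMA countable_rational_points, auto)
  have "U = \<Union>\<B>"
  proof
    show "\<Union>\<B> \<subseteq> U" by (auto simp: \<B>_def)
    show "U \<subseteq> \<Union>\<B>"
    proof
      fix x assume "x \<in> U"
      then obtain r where r: "r > 0" "mball x r \<subseteq> U" and x: "x \<in> M0_space w"
        using U unfolding openin_mtopology by blast
      obtain c where c: "c \<in> rational_points" "M_dist w x c < r / 2"
        using rational_points_dense[OF x, of "r / 2"] r by auto
      \<comment> \<open>The radius exceeds the distance from \<open>c\<close> to \<open>x\<close>,
        so the ball contains \<open>x\<close>; being below \<open>r / 2\<close>, it keeps the ball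
        within distance \<open>r\<close> of \<open>x\<close>.\<close>
      obtain q where q: "M_dist w x c < real_of_rat q" "real_of_rat q < r / 2"
        using of_rat_dense[OF c(2)] by auto
      have "mball c (real_of_rat q) \<subseteq> mball x r"
      proof
        fix y assume y: "y \<in> mball c (real_of_rat q)"
        then have "M_dist w x y \<le> M_dist w x c + M_dist w c y"
          using x by (intro triangle) auto
        then show "y \<in> mball x r" using y q x by auto
      qed
      then have "mball c (real_of_rat q) \<in> \<B>"
        unfolding \<B>_def using r c by blast
      moreover have "x \<in> mball c (real_of_rat q)"
        using x c rational_points_subset q by (auto simp: commute)
      ultimately show "x \<in> \<Union>\<B>" by (rule UnionI)
    qed
  qed
  moreover have "\<Union>\<B> \<in> sets coeff_space"
    using \<open>countable \<B>\<close> rational_points_subset by (intro sets.countable_Union) (auto simp: \<B>_def intro: sets_ball)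
  ultimately show ?thesis by simp
qed

section \<open>Borel laws and test functions on the multiscale space\<close>

lemma space_borel_M0: "space (borel_M0 w) = M0_space w"
  unfolding borel_M0_def by (rule space_measure_of) (auto simp: openin_mtopology)

text \<open>This is the map under which \<open>law_on_M0\<close> takes its image; naming it lets
  integrals against that law be pulled back to the product space.\<close>

definition into_M0 :: "(nat \<times> nat \<Rightarrow> real) \<Rightarrow> nat \<times> nat \<Rightarrow> real" where
  "into_M0 x = (if x \<in> M0_space w then x else (\<lambda>i\<in>wavelet_idx. 0))"

lemma into_M0_in [simp]: "into_M0 x \<in> M0_space w"
  by (simp add: into_M0_def)

lemma measurable_into_M0 [measurable]: "into_M0 \<in> coeff_space \<rightarrow>\<^sub>M borel_M0 w"
  unfolding borel_M0_def
proof (rule measurable_measure_of)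
  fix U assume "U \<in> {U. openin mtopology U}"
  then have U: "openin mtopology U" by simp
  note [measurable] = sets_openin[OF U] sets_M0_space
  have "into_M0 -` U \<inter> space coeff_space
      = {x\<in>space coeff_space. if x \<in> M0_space w then x \<in> U else (\<lambda>i\<in>wavelet_idx. 0) \<in> U}"
    by (auto simp: into_M0_def)
  also have "\<dots> \<in> sets coeff_space" by measurable
  finally show "into_M0 -` U \<inter> space coeff_space \<in> sets coeff_space" .
qed (auto simp: openin_mtopology)

text \<open>The test functions of \<open>BL_dist\<close>. Membership restricts \<open>F\<close> on
  the multiscale space only; elsewhere \<open>F\<close> is arbitrary, and for this reason it is
  composed with \<open>into_M0\<close> or \<open>truncate\<close> before it is integrated over the
  product space.\<close>

definition BL_ball :: "((nat \<times> nat \<Rightarrow> real) \<Rightarrow> real) set" where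
  "BL_ball = {F. sup_norm_on (M0_space w) F + Lip_norm_on (M0_space w) (M_dist w) F \<le> 1}"

lemma BL_ball_abs_le:
  assumes "F \<in> BL_ball" "x \<in> M0_space w"
  shows "\<bar>F x\<bar> \<le> 1"
proof -
  have "ennreal \<bar>F x\<bar> \<le> sup_norm_on (M0_space w) F"
    unfolding sup_norm_on_def using assms(2) by (rule SUP_upper)
  also have "\<dots> \<le> 1" using assms(1) unfolding BL_ball_def
    by (metis (no_types, lifting) add_increasing2 mem_Collect_eq order_refl order_trans zero_le)
  finally show ?thesis by simp
qed

lemma BL_ball_Lipschitz:
  assumes "F \<in> BL_ball" and x: "x \<in> M0_space w" and y: "y \<in> M0_space w"
  shows "\<bar>F x - F y\<bar> \<le> M_dist w x y"
proof (cases "x = y")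
  case False
  then have pos: "M_dist w x y > 0" using x y by (simp add: mdist_pos_eq)
  have "ennreal (\<bar>F x - F y\<bar> / M_dist w x y) \<le> Lip_norm_on (M0_space w) (M_dist w) F"
    unfolding Lip_norm_on_def using x y False by (intro SUP_upper2[of "(x, y)"]) auto
  also have "\<dots> \<le> 1" using assms(1) unfolding BL_ball_def
    by (metis (no_types, lifting) add_increasing mem_Collect_eq order_refl order_trans zero_le)
  finally have "\<bar>F x - F y\<bar> / M_dist w x y \<le> 1" by simp
  then show ?thesis using pos by (simp add: field_simps)
qed (simp add: x)

lemma zero_in_BL_ball: "(\<lambda>_. 0) \<in> BL_ball"
  by (auto simp: BL_ball_def sup_norm_on_def Lip_norm_on_def split_beta SUP_constant bot_ennreal)

lemma BL_ball_measurable: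
  assumes F: "F \<in> BL_ball"
  shows "F \<in> borel_measurable (borel_M0 w)"
proof (rule borel_measurableI)
  fix S :: "real set" assume "open S"
  have "openin mtopology (F -` S \<inter> M0_space w)"
    unfolding openin_mtopology
  proof safe
    fix x assume x: "F x \<in> S" "x \<in> M0_space w"
    then obtain e where e: "e > 0" "\<And>y. dist y (F x) < e \<Longrightarrow> y \<in> S"
      using \<open>open S\<close> by (auto simp: open_dist)
    have "y \<in> F -` S \<inter> M0_space w" if "y \<in> mball x e" for y
      using e(2)[of "F y"] BL_ball_Lipschitz[OF F x(2), of y] that
      by (auto simp: dist_real_def abs_minus_commute)
    then show "\<exists>r>0. mball x r \<subseteq> F -` S \<inter> M0_space w"
      using e(1) by blast
  qed
  then show "F -` S \<inter> space (borel_M0 w) \<in> sets (borel_M0 w)"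
    unfolding space_borel_M0 unfolding borel_M0_def by (subst sets_measure_of) (auto simp: openin_mtopology)
qed

text \<open>Evaluation at the rational points maps the ball into the separable metric space
  \<open>nat \<Rightarrow> real\<close>, and pointwise limits on a dense set of equi-Lipschitz functions are pointwise limits
  everywhere. This reduces the supremum in \<^const>\<open>BL_dist\<close> to a countable one.\<close>

lemma BL_ball_separable:
  obtains C where "countable C" "C \<subseteq> BL_ball" "C \<noteq> {}"
    "\<And>F. F \<in> BL_ball \<Longrightarrow> \<exists>G. (\<forall>n. G n \<in> C) \<and> (\<forall>x\<in>M0_space w. (\<lambda>n::nat. G n x) \<longlonglongrightarrow> F x)"
proof -
  define d where "d = from_nat_into rational_points"
  have ne: "rational_points \<noteq> {}" using rational_points_dense[of "\<lambda>i\<in>wavelet_idx. 0" 1] by auto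
  have d: "range d = rational_points"
    unfolding d_def using ne countable_rational_points by (rule range_from_nat_into)
  define \<Phi> where "\<Phi> = (\<lambda>F::(nat \<times> nat \<Rightarrow> real) \<Rightarrow> real. (\<lambda>n::nat. F (d n)))"
  obtain T where T: "countable T" "T \<subseteq> \<Phi> ` BL_ball" "\<Phi> ` BL_ball \<subseteq> closure T"
    using separable[of "\<Phi> ` BL_ball"] by metis
  define C where "C = inv_into BL_ball \<Phi> ` T"
  have C: "\<exists>G. (\<forall>n. G n \<in> C) \<and> (\<forall>x\<in>M0_space w. (\<lambda>n::nat. G n x) \<longlonglongrightarrow> F x)" if F: "F \<in> BL_ball" for F
  proof -
    have "\<Phi> F \<in> closure T" using T F by auto
    then obtain t where t: "\<And>n. t n \<in> T" "t \<longlonglongrightarrow> \<Phi> F"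
      unfolding closure_sequential by auto
    define G where "G = (\<lambda>n. inv_into BL_ball \<Phi> (t n))"
    have GC: "G n \<in> C" for n by (simp add: G_def C_def t)
    have G: "G n \<in> BL_ball" for n using t T by (auto simp: G_def intro!: inv_into_into)
    have "\<Phi> (G n) = t n" for n
      unfolding G_def using t T by (intro f_inv_into_f[of "t n" \<Phi> BL_ball]) auto
    then have "(\<lambda>n. \<Phi> (G n)) \<longlonglongrightarrow> \<Phi> F" using t by simp
    then have "(\<lambda>n. \<Phi> (G n) j) \<longlonglongrightarrow> \<Phi> F j" for j
      by (rule continuous_on_tendsto_compose[OF continuous_on_product_coordinates]) auto
    then have lim: "(\<lambda>n. G n c) \<longlonglongrightarrow> F c" if "c \<in> rational_points" for c
      using that unfolding \<Phi>_def d[symmetric] by blast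
    have "(\<lambda>n. G n x) \<longlonglongrightarrow> F x" if x: "x \<in> M0_space w" for x
    proof (rule LIMSEQ_I)
      fix e :: real assume "e > 0"
      obtain c where c: "c \<in> rational_points" "M_dist w x c < e / 3"
        using rational_points_dense[OF x, of "e / 3"] \<open>e > 0\<close> by auto
      obtain N where N: "\<And>n. n \<ge> N \<Longrightarrow> norm (G n c - F c) < e / 3"
        using LIMSEQ_D[OF lim[OF c(1)], of "e / 3"] \<open>e > 0\<close> by auto
      have c': "c \<in> M0_space w" using c rational_points_subset by auto
      show "\<exists>N. \<forall>n\<ge>N. norm (G n x - F x) < e"
      proof (intro exI allI impI)
        fix n assume "n \<ge> N"
        then show "norm (G n x - F x) < e"
          using N[of n] BL_ball_Lipschitz[OF G[of n] x c'] BL_ball_Lipschitz[OF F x c'] c(2)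
          unfolding real_norm_def by linarith
      qed
    qed
    then show ?thesis using GC by auto
  qed
  show ?thesis
  proof
    show "countable C" unfolding C_def using T by auto
    show "C \<subseteq> BL_ball" unfolding C_def using T by (auto intro!: inv_into_into)
    show "C \<noteq> {}" using C[OF zero_in_BL_ball] by auto
  qed (rule C)
qed

end

section \<open>Product laws\<close>

text \<open>Both sides are finite measures, so agreement on cylinders suffices. A coordinatewise map
  pulls a cylinder back to a cylinder over the same finite index set, and both masses are the same
  finite product.\<close>

lemma distr_PiM_coordinatewise:
  assumes M: "\<And>i. i \<in> I \<Longrightarrow> prob_space (M i)"
    and f: "\<And>i. i \<in> I \<Longrightarrow> f i \<in> M i \<rightarrow>\<^sub>M N i"
  shows "distr (PiM I M) (PiM I N) (\<lambda>x. \<lambda>i\<in>I. f i (x i)) = PiM I (\<lambda>i. distr (M i) (N i) (f i))"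
    (is "?L = PiM I ?D")
proof -
  have sets_D: "sets (PiM I ?D) = sets (PiM I N)"
    by (rule sets_PiM_cong) auto
  have meas: "(\<lambda>x. \<lambda>i\<in>I. f i (x i)) \<in> PiM I M \<rightarrow>\<^sub>M PiM I N"
    using f by (intro measurable_restrict measurable_compose[OF measurable_component_singleton]) auto
  have D: "prob_space (?D i)" if "i \<in> I" for i
    using M f that by (intro prob_space.prob_space_distr) auto
  show ?thesis
  proof (rule measure_eqI_PiM_infinite[of _ I ?D])
    show "finite_measure ?L"
      using prob_space.prob_space_distr[OF prob_space_PiM[OF M] meas] by (auto simp: prob_space_def)
    fix A J assume J: "finite J" "J \<subseteq> I" and A: "\<And>i. i \<in> J \<Longrightarrow> A i \<in> sets (?D i)"
    have "prod_emb I ?D J (Pi\<^sub>E J A) \<in> sets (PiM I ?D)"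
      using J A by (intro sets_PiM_I) auto
    then have "emeasure ?L (prod_emb I ?D J (Pi\<^sub>E J A))
        = emeasure (PiM I M) ((\<lambda>x. \<lambda>i\<in>I. f i (x i)) -` prod_emb I ?D J (Pi\<^sub>E J A) \<inter> space (PiM I M))"
      using sets_D by (intro emeasure_distr meas) simp
    also have "(\<lambda>x. \<lambda>i\<in>I. f i (x i)) -` prod_emb I ?D J (Pi\<^sub>E J A) \<inter> space (PiM I M)
        = prod_emb I M J (\<Pi>\<^sub>E i\<in>J. f i -` A i \<inter> space (M i))"
      using J measurable_space[OF f] by (auto simp: prod_emb_def space_PiM PiE_iff subset_eq)
    also have "emeasure (PiM I M) \<dots> = (\<Prod>i\<in>J. emeasure (M i) (f i -` A i \<inter> space (M i)))"
      using J A f by (intro emeasure_PiM_emb M) (auto intro: measurable_sets)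
    also have "\<dots> = (\<Prod>i\<in>J. emeasure (?D i) (A i))"
      using J A f by (intro prod.cong) (auto simp: emeasure_distr subset_eq)
    also have "\<dots> = emeasure (PiM I ?D) (prod_emb I ?D J (Pi\<^sub>E J A))"
      using J A D by (intro emeasure_PiM_emb[symmetric]) auto
    finally show "emeasure ?L (prod_emb I ?D J (Pi\<^sub>E J A)) = emeasure (PiM I ?D) (prod_emb I ?D J (Pi\<^sub>E J A))" .
  qed (auto simp: sets_D)
qed

section \<open>Total variation bounds for product densities\<close>

lemma integral_density_diff_le:
  fixes F g p :: "real \<Rightarrow> real"
  assumes [measurable]: "F \<in> borel_measurable borel"
    and F: "\<And>y. \<bar>F y\<bar> \<le> 1"
    and g: "integrable lborel g" "\<And>y. 0 \<le> g y" and p: "integrable lborel p" "\<And>y. 0 \<le> p y"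
  shows "\<bar>(\<integral>y. F y \<partial>density lborel g) - (\<integral>y. F y \<partial>density lborel p)\<bar> \<le> (\<integral>y. \<bar>g y - p y\<bar> \<partial>lborel)"
proof -
  have int: "integrable lborel (\<lambda>y. q y * F y)" if "integrable lborel q" for q
  proof (rule Bochner_Integration.integrable_bound[OF that])
    show "AE y in lborel. norm (q y * F y) \<le> norm (q y)"
      using F by (intro AE_I2) (simp add: abs_mult mult_left_le)
    show "(\<lambda>y. q y * F y) \<in> borel_measurable lborel"
      using borel_measurable_integrable[OF that] by measurable
  qed
  have "(\<integral>y. F y \<partial>density lborel g) - (\<integral>y. F y \<partial>density lborel p) = (\<integral>y. g y * F y - p y * F y \<partial>lborel)"
    using g p int by (simp add: integral_density)
  also have "\<bar>\<dots>\<bar> \<le> (\<integral>y. \<bar>g y * F y - p y * F y\<bar> \<partial>lborel)"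
    by (rule integral_abs_bound)
  also have "\<dots> \<le> (\<integral>y. \<bar>g y - p y\<bar> \<partial>lborel)"
  proof (rule integral_mono)
    show "\<bar>g y * F y - p y * F y\<bar> \<le> \<bar>g y - p y\<bar>" for y
      using F[of y] by (simp add: abs_mult mult_left_le flip: left_diff_distrib)
  qed (use g p int in auto)
  finally show ?thesis .
qed

text \<open>The factors are exchanged one at a time, and each exchange costs the L1 distance of the
  two densities concerned.\<close>

lemma integral_PiM_density_diff_le:
  fixes F :: "('i \<Rightarrow> real) \<Rightarrow> real" and g p :: "'i \<Rightarrow> real \<Rightarrow> real"
  assumes A: "finite A" and F: "F \<in> borel_measurable (PiM A (\<lambda>_. borel))" "\<And>x. \<bar>F x\<bar> \<le> 1"
    and g: "\<And>i. prob_space (density lborel (g i))" "\<And>i. integrable lborel (g i)" "\<And>i y. 0 \<le> g i y"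
    and p: "\<And>i. prob_space (density lborel (p i))" "\<And>i. integrable lborel (p i)" "\<And>i y. 0 \<le> p i y"
  shows "\<bar>(\<integral>x. F x \<partial>PiM A (\<lambda>i. density lborel (g i))) - (\<integral>x. F x \<partial>PiM A (\<lambda>i. density lborel (p i)))\<bar>
    \<le> (\<Sum>i\<in>A. \<integral>y. \<bar>g i y - p i y\<bar> \<partial>lborel)"
  using A F
proof (induction A arbitrary: F rule: finite_induct)
  case empty
  then show ?case by (simp add: PiM_empty)
next
  case (insert i A)
  define G where "G = (\<lambda>i. density lborel (\<lambda>x. ennreal (g i x)))"
  define P where "P = (\<lambda>i. density lborel (\<lambda>x. ennreal (p i x)))"
  interpret G: prob_space "G j" for j unfolding G_def by (rule g)
  interpret P: prob_space "P j" for j unfolding P_def by (rule p)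
  interpret GG: product_sigma_finite G by standard
  interpret PP: product_sigma_finite P by standard
  interpret GA: prob_space "PiM A G" by (rule prob_space_PiM) unfold_locales
  interpret PA: prob_space "PiM A P" by (rule prob_space_PiM) unfold_locales
  interpret GI: prob_space "PiM (insert i A) G" by (rule prob_space_PiM) unfold_locales
  interpret PI: prob_space "PiM (insert i A) P" by (rule prob_space_PiM) unfold_locales
  have sets [measurable_cong]: "sets (G j) = sets borel" "sets (P j) = sets borel" for j
    by (auto simp: G_def P_def)
  have sets_PiM [measurable_cong]: "sets (PiM B G) = sets (PiM B (\<lambda>_. borel))" 
     "sets (PiM B P) = sets (PiM B (\<lambda>_. borel))" for B
    by (auto intro!: sets_PiM_cong simp: sets)
  note [measurable] = insert.prems(1)
  have upd: "(\<lambda>(x, y). F (x(i := y))) \<in> borel_measurable (PiM A (\<lambda>_. borel) \<Otimes>\<^sub>M borel)"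
    using measurable_compose[OF measurable_add_dim[of i A "\<lambda>_. borel"] insert.prems(1)]
    by (simp add: case_prod_unfold)
  have upd1: "(\<lambda>y. F (x(i := y))) \<in> borel_measurable borel" if "x \<in> space (PiM A (\<lambda>_. borel))" for x
    using measurable_Pair2[OF upd that] by simp
  \<comment> \<open>The new coordinate is integrated out under either law. Passing from
    \<open>FG\<close> to \<open>FP\<close> costs the L1 distance at \<open>i\<close>; then
    \<open>FP\<close> is a bounded function of the remaining coordinates, to which the induction
    hypothesis applies.\<close>
  define FG where "FG = (\<lambda>x. \<integral>y. F (x(i := y)) \<partial>G i)"
  define FP where "FP = (\<lambda>x. \<integral>y. F (x(i := y)) \<partial>P i)"
  have FG_meas [measurable]: "FG \<in> borel_measurable (PiM A (\<lambda>_. borel))"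
    unfolding FG_def by (rule G.borel_measurable_lebesgue_integral)
      (use upd in \<open>simp cong: measurable_cong_sets add: sets_pair_measure_cong[OF refl sets(1)]\<close>)
  have FP_meas [measurable]: "FP \<in> borel_measurable (PiM A (\<lambda>_. borel))"
    unfolding FP_def by (rule P.borel_measurable_lebesgue_integral)
      (use upd in \<open>simp cong: measurable_cong_sets add: sets_pair_measure_cong[OF refl sets(2)]\<close>)
  \<comment> \<open>The bounds on \<open>FG\<close> and \<open>FP\<close> are required at every
    \<open>x\<close>, also outside the product space, so \<open>f\<close> is not assumed measurable;
    a non-integrable function has integral 0 by convention.\<close>
  have abs_integral: "\<bar>\<integral>y. f y \<partial>M\<bar> \<le> 1" if "prob_space M" "\<And>y. \<bar>f y\<bar> \<le> 1" for f :: "real \<Rightarrow> real" and M :: "real measure"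
  proof -
    interpret prob_space M by fact
    have "\<bar>\<integral>y. f y \<partial>M\<bar> \<le> (\<integral>y. \<bar>f y\<bar> \<partial>M)"
      by (rule Bochner_Integration.integral_abs_bound)
    also have "\<dots> \<le> 1"
    proof (cases "integrable M (\<lambda>y. \<bar>f y\<bar>)")
      case True
      then have "(\<integral>y. \<bar>f y\<bar> \<partial>M) \<le> (\<integral>y. 1 \<partial>M)" using that by (intro integral_mono) auto
      then show ?thesis by (simp add: prob_space)
    qed (simp add: not_integrable_integral_eq)
    finally show ?thesis .
  qed
  have FG_le: "\<bar>FG x\<bar> \<le> 1" and FP_le: "\<bar>FP x\<bar> \<le> 1" for x
    unfolding FG_def FP_def using insert.prems(2) by (auto intro!: abs_integral G.prob_space_axioms P.prob_space_axioms)
  have intG: "integrable (PiM (insert i A) G) F"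
    by (rule GI.integrable_const_bound[where B=1]) (use insert.prems in \<open>auto cong: measurable_cong_sets[OF sets_PiM(1) refl]\<close>)
  have intP: "integrable (PiM (insert i A) P) F"
    by (rule PI.integrable_const_bound[where B=1]) (use insert.prems in \<open>auto cong: measurable_cong_sets[OF sets_PiM(2) refl]\<close>)
  have int1: "integrable (PiM A G) FG" "integrable (PiM A G) FP"
    by (rule GA.integrable_const_bound[where B=1]; (use FG_le FP_le in \<open>auto intro: AE_I2\<close>))+
  have close: "\<bar>FG x - FP x\<bar> \<le> (\<integral>y. \<bar>g i y - p i y\<bar> \<partial>lborel)" if "x \<in> space (PiM A (\<lambda>_. borel))" for x
    unfolding FG_def FP_def G_def P_def
    using insert.prems(2) g p upd1[OF that] by (intro integral_density_diff_le) auto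
  have "\<bar>(\<integral>x. FG x \<partial>PiM A G) - (\<integral>x. FP x \<partial>PiM A G)\<bar> = \<bar>\<integral>x. FG x - FP x \<partial>PiM A G\<bar>"
    using int1 by simp
  also have "\<dots> \<le> (\<integral>x. \<bar>FG x - FP x\<bar> \<partial>PiM A G)" by (rule integral_abs_bound)
  also have "\<dots> \<le> (\<integral>x. (\<integral>y. \<bar>g i y - p i y\<bar> \<partial>lborel) \<partial>PiM A G)"
    using int1 close sets_eq_imp_space_eq[OF sets_PiM(1)[of A]] by (intro integral_mono) auto
  also have "\<dots> = (\<integral>y. \<bar>g i y - p i y\<bar> \<partial>lborel)" by (simp add: GA.prob_space)
  finally have "\<bar>(\<integral>x. FG x \<partial>PiM A G) - (\<integral>x. FP x \<partial>PiM A G)\<bar> \<le> (\<integral>y. \<bar>g i y - p i y\<bar> \<partial>lborel)" .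
  moreover have "\<bar>(\<integral>x. FP x \<partial>PiM A G) - (\<integral>x. FP x \<partial>PiM A P)\<bar> \<le> (\<Sum>i\<in>A. \<integral>y. \<bar>g i y - p i y\<bar> \<partial>lborel)"
    unfolding G_def P_def by (rule insert.IH[OF FP_meas FP_le])
  moreover have "(\<integral>x. F x \<partial>PiM (insert i A) G) = (\<integral>x. FG x \<partial>PiM A G)"
    unfolding FG_def by (rule GG.product_integral_insert[OF insert.hyps intG])
  moreover have "(\<integral>x. F x \<partial>PiM (insert i A) P) = (\<integral>x. FP x \<partial>PiM A P)"
    unfolding FP_def by (rule PP.product_integral_insert[OF insert.hyps intP])
  ultimately show ?case
    using insert.hyps unfolding G_def[symmetric] P_def[symmetric] by simp
qed

section \<open>Levelwise tails and reduction to finitely many coefficients\<close>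

locale coordinate_laws =
  fixes R :: "nat \<times> nat \<Rightarrow> real measure"
  assumes prob_space_R: "prob_space (R i)"
    and sets_R [simp, measurable_cong]: "sets (R i) = sets borel"
begin

sublocale R: prob_space "R i" for i by (rule prob_space_R)

sublocale P: prob_space "PiM wavelet_idx R" by (rule prob_space_PiM) (rule prob_space_R)

lemma sets_PiM_R [measurable_cong]: "sets (PiM wavelet_idx R) = sets coeff_space"
  by (rule sets_PiM_cong) auto

lemma space_PiM_R: "space (PiM wavelet_idx R) = space coeff_space"
  by (rule sets_eq_imp_space_eq) (rule sets_PiM_R)

text \<open>The union bound over the \<open>2 ^ l\<close> coefficients of a level. It turns tail
  estimates for the maximum into one-dimensional ones.\<close>

definition level_tail :: "nat \<Rightarrow> real \<Rightarrow> real" where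
  "level_tail l M = (\<Sum>k<2 ^ l. measure (R (l, k)) {u. M < \<bar>u\<bar>})"

lemma level_tail_nonneg: "level_tail l M \<ge> 0"
  by (auto simp: level_tail_def intro!: sum_nonneg)

lemma sets_level_max_gt [measurable]: "{x\<in>space coeff_space. M < level_max x l} \<in> sets coeff_space"
  by (intro borel_measurable_less measurable_level_max) (auto simp: measurable_coeff)

lemma prob_level_max_le: "P.prob {x\<in>space coeff_space. M < level_max x l} \<le> level_tail l M"
proof -
  let ?A = "\<lambda>k. {x\<in>space coeff_space. M < \<bar>x (l, k)\<bar>}"
  have A: "?A k \<in> P.events" if "k < 2 ^ l" for k
    unfolding sets_PiM_R using that by (intro borel_measurable_less) (auto simp: measurable_coeff)
  have "{x\<in>space coeff_space. M < level_max x l} = (\<Union>k\<in>{..<2 ^ l}. ?A k)"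
    using level_max_le_iff[of _ l M] by (auto simp: not_le[symmetric])
  then have "P.prob {x\<in>space coeff_space. M < level_max x l} \<le> (\<Sum>k<2 ^ l. P.prob (?A k))"
    using A by (auto intro!: P.finite_measure_subadditive_finite)
  also have "\<dots> = level_tail l M"
    unfolding level_tail_def
  proof (intro sum.cong refl)
    fix k :: nat assume "k \<in> {..<2 ^ l}"
    then have k: "(l, k) \<in> wavelet_idx" by simp
    have "measure (R (l, k)) {u. M < \<bar>u\<bar>} = measure (distr (PiM wavelet_idx R) (R (l, k)) (\<lambda>x. x (l, k))) {u. M < \<bar>u\<bar>}"
      using distr_PiM_component[of wavelet_idx R "(l, k)"] k prob_space_R by simp
    also have "\<dots> = P.prob ((\<lambda>x. x (l, k)) -` {u. M < \<bar>u\<bar>} \<inter> space (PiM wavelet_idx R))"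
      using k by (intro measure_distr) auto
    also have "(\<lambda>x. x (l, k)) -` {u. M < \<bar>u\<bar>} \<inter> space (PiM wavelet_idx R) = ?A k"
      by (auto simp: space_PiM_R)
    finally show "P.prob (?A k) = measure (R (l, k)) {u. M < \<bar>u\<bar>}" ..
  qed
  finally show ?thesis .
qed

end

locale weighted_laws = weights w + coordinate_laws R for w R
begin

text \<open>Borel--Cantelli: for fixed \<open>\<delta>\<close>, summable tails leave almost surely
  only finitely many levels above \<open>\<delta> * w l\<close>; letting \<open>\<delta>\<close>
  decrease to 0 gives the required decay.\<close>

lemma AE_in_M0:
  assumes "\<And>\<delta>. \<delta> > 0 \<Longrightarrow> summable (\<lambda>l. level_tail l (\<delta> * w l))"
  shows "AE x in PiM wavelet_idx R. x \<in> M0_space w"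
proof -
  have "AE x in PiM wavelet_idx R. \<forall>\<^sub>F l in sequentially. level_max x l \<le> \<delta> * w l" if "\<delta> > 0" for \<delta>
  proof -
    have "summable (\<lambda>l. P.prob {x\<in>space coeff_space. \<delta> * w l < level_max x l})"
      by (rule summable_comparison_test'[OF assms[OF that], of 0]) (simp add: prob_level_max_le)
    then have "AE x in PiM wavelet_idx R. \<forall>\<^sub>F l in sequentially.
        x \<in> space (PiM wavelet_idx R) - {x\<in>space coeff_space. \<delta> * w l < level_max x l}"
      by (intro borel_cantelli_AE1) (auto simp: sets_PiM_R sets_level_max_gt P.emeasure_eq_measure)
    then show ?thesis
      by eventually_elim (auto simp: space_PiM_R elim!: eventually_mono)
  qed
  \<comment> \<open>The values \<open>1 / (m + 1)\<close> suffice, so only countably many null sets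
    are discarded.\<close>
  then have "AE x in PiM wavelet_idx R. \<forall>m::nat. \<forall>\<^sub>F l in sequentially. level_max x l \<le> inverse (real (Suc m)) * w l"
    by (subst AE_all_countable) auto
  then show ?thesis
    using AE_space
  proof eventually_elim
    case (elim x)
    have "(\<lambda>l. level_max x l / w l) \<longlonglongrightarrow> 0"
    proof (rule order_tendstoI)
      fix e :: real assume "0 < e"
      then obtain m where m: "inverse (real (Suc m)) < e" using reals_Archimedean by blast
      from elim(1) have "\<forall>\<^sub>F l in sequentially. level_max x l \<le> inverse (real (Suc m)) * w l" by blast
      then show "\<forall>\<^sub>F l in sequentially. level_max x l / w l < e"
      proof eventually_elim
        case (elim l)
        then have "level_max x l / w l \<le> inverse (real (Suc m))"
          using w_pos[of l] by (simp add: pos_divide_le_eq del: of_nat_Suc)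
        then show ?case using m by simp
      qed
    next
      fix e :: real assume "e < 0"
      then show "\<forall>\<^sub>F l in sequentially. e < level_max x l / w l"
        using level_max_ratio_nonneg by (intro always_eventually) (auto intro: less_le_trans)
    qed
    then show ?case using elim(2) by (simp add: M0_space_iff space_PiM_R space_coeff_space)
  qed
qed

lemma measurable_BL_ball_into_M0 [measurable]:
  "F \<in> BL_ball \<Longrightarrow> (\<lambda>x. F (into_M0 x)) \<in> borel_measurable coeff_space"
  by (rule measurable_compose[OF measurable_into_M0 BL_ball_measurable])

text \<open>A truncation depends on finitely many coordinates and lies in the multiscale space,
  where \<open>into_M0\<close> is the identity. The test function thus lives on a finite product,
  the form in which product densities are compared.\<close>

lemma BL_ball_truncate_measurable:
  assumes "F \<in> BL_ball"
  shows "(\<lambda>x. F (truncate J x)) \<in> borel_measurable (PiM (low_idx J) (\<lambda>_. borel))"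
proof -
  have "truncate J \<in> PiM (low_idx J) (\<lambda>_. borel) \<rightarrow>\<^sub>M coeff_space"
    unfolding truncate_def
  proof (rule measurable_restrict)
    fix i :: "nat \<times> nat" assume "i \<in> wavelet_idx"
    then show "(\<lambda>x. if fst i < J then x i else 0) \<in> borel_measurable (PiM (low_idx J) (\<lambda>_. borel))"
      by (cases "fst i < J") (auto simp: low_idx_def)
  qed
  from measurable_compose[OF this measurable_BL_ball_into_M0[OF assms]]
  show ?thesis by (simp add: into_M0_def)
qed

lemma truncate_restrict: "truncate J (restrict x (low_idx J)) = truncate J x"
  by (auto simp: truncate_def low_idx_def fun_eq_iff)

lemma BL_ball_truncate_measurable' [measurable]:
  assumes "F \<in> BL_ball"
  shows "(\<lambda>x. F (truncate J x)) \<in> borel_measurable coeff_space"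
  using measurable_compose[OF measurable_restrict_subset[OF low_idx_subset] BL_ball_truncate_measurable[OF assms, of J]]
  by (simp add: truncate_restrict)

lemma integral_law_on_M0:
  assumes "F \<in> BL_ball" "sets Q = sets coeff_space"
  shows "(\<integral>x. F x \<partial>law_on_M0 w Q) = (\<integral>x. F (into_M0 x) \<partial>Q)"
proof -
  have "law_on_M0 w Q = distr Q (borel_M0 w) into_M0"
    by (simp add: law_on_M0_def into_M0_def[abs_def])
  moreover have "into_M0 \<in> Q \<rightarrow>\<^sub>M borel_M0 w"
    using measurable_into_M0 assms(2) by (simp cong: measurable_cong_sets)
  ultimately show ?thesis
    using BL_ball_measurable[OF assms(1)] by (simp add: integral_distr)
qed

text \<open>Unless some level \<open>l \<ge> J\<close> exceeds \<open>\<delta> * w l\<close>,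
  truncation moves \<open>x\<close> by at most \<open>\<delta>\<close>, hence \<open>F\<close> by at
  most \<open>\<delta>\<close>. On the exceptional event \<open>F\<close> changes by at most 2, and
  the probability of that event is at most the tail of the series.\<close>

lemma truncation_error:
  assumes F: "F \<in> BL_ball" and "\<delta> > 0" and M0: "AE x in PiM wavelet_idx R. x \<in> M0_space w"
    and B: "summable B" "\<And>l. l \<ge> J \<Longrightarrow> level_tail l (\<delta> * w l) \<le> B l"
  shows "\<bar>(\<integral>x. F (into_M0 x) \<partial>PiM wavelet_idx R) - (\<integral>x. F (truncate J x) \<partial>PiM wavelet_idx R)\<bar>
    \<le> \<delta> + 2 * (\<Sum>l. B (l + J))"
proof -
  \<comment> \<open>Index 0 stands for level \<open>J\<close>, since the levels below
    \<open>J\<close> are untouched by truncation.\<close>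
  define E where "E = (\<lambda>l. {x\<in>space coeff_space. \<delta> * w (l + J) < level_max x (l + J)})"
  have E: "E l \<in> P.events" for l unfolding E_def sets_PiM_R by (rule sets_level_max_gt)
  have B': "summable (\<lambda>l. B (l + J))" using B(1) by (subst summable_iff_shift)
  have prob_E: "P.prob (E l) \<le> B (l + J)" for l
    using prob_level_max_le[of "\<delta> * w (l + J)" "l + J"] B(2)[of "l + J"] by (simp add: E_def)
  have sum_E: "summable (\<lambda>l. P.prob (E l))"
    by (rule summable_comparison_test'[OF B', of 0]) (simp add: prob_E)
  have "P.prob (\<Union>l. E l) \<le> (\<Sum>l. P.prob (E l))"
    using E sum_E by (intro P.finite_measure_subadditive_countably) auto
  also have "\<dots> \<le> (\<Sum>l. B (l + J))" by (intro suminf_le prob_E sum_E B')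
  finally have prob: "P.prob (\<Union>l. E l) \<le> (\<Sum>l. B (l + J))" .
  have int: "integrable (PiM wavelet_idx R) (\<lambda>x. F (into_M0 x))"
    "integrable (PiM wavelet_idx R) (\<lambda>x. F (truncate J x))"
    using F BL_ball_abs_le[OF F] by (auto intro!: P.integrable_const_bound[where B=1] AE_I2)
  have UE: "(\<Union>l. E l) \<in> P.events" using E by auto
  have int_E: "integrable (PiM wavelet_idx R) (\<lambda>x. 2 * indicator (\<Union>l. E l) x :: real)"
    using UE by (intro integrable_mult_right integrable_real_indicator) (auto simp: P.emeasure_eq_measure)
  have "\<bar>(\<integral>x. F (into_M0 x) \<partial>PiM wavelet_idx R) - (\<integral>x. F (truncate J x) \<partial>PiM wavelet_idx R)\<bar>
      = \<bar>\<integral>x. F (into_M0 x) - F (truncate J x) \<partial>PiM wavelet_idx R\<bar>"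
    using int by simp
  also have "\<dots> \<le> (\<integral>x. \<bar>F (into_M0 x) - F (truncate J x)\<bar> \<partial>PiM wavelet_idx R)"
    by (rule integral_abs_bound)
  also have "\<dots> \<le> (\<integral>x. \<delta> + 2 * indicator (\<Union>l. E l) x \<partial>PiM wavelet_idx R)"
  proof (rule integral_mono_AE)
    show "AE x in PiM wavelet_idx R. \<bar>F (into_M0 x) - F (truncate J x)\<bar> \<le> \<delta> + 2 * indicator (\<Union>l. E l) x"
      using M0
    proof eventually_elim
      case (elim x)
      show ?case
      proof (cases "x \<in> (\<Union>l. E l)")
        case True
        then show ?thesis
          using BL_ball_abs_le[OF F, of "into_M0 x"] BL_ball_abs_le[OF F, of "truncate J x"] \<open>\<delta> > 0\<close>
          by simp
      next
        case False
        have "level_max x l \<le> \<delta> * w l" if "l \<ge> J" for l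
        proof -
          have "x \<notin> E (l - J)" using False by blast
          then show ?thesis using that elim by (auto simp: E_def space_coeff_space M0_space_iff)
        qed
        then have "M_dist w x (truncate J x) \<le> \<delta>"
          using \<open>\<delta> > 0\<close> by (intro M_dist_truncate_le) auto
        then have "\<bar>F x - F (truncate J x)\<bar> \<le> \<delta>"
          using BL_ball_Lipschitz[OF F elim, of "truncate J x"] by simp
        then show ?thesis using elim False by (simp add: into_M0_def)
      qed
    qed
  qed (use int int_E in auto)
  also have "\<dots> = \<delta> + 2 * P.prob (\<Union>l. E l)"
    using UE int_E by (subst Bochner_Integration.integral_add) (auto simp: P.prob_space)
  finally show ?thesis using prob by simp
qed

lemma integral_truncate:
  assumes "F \<in> BL_ball"
  shows "(\<integral>x. F (truncate J x) \<partial>PiM wavelet_idx R) = (\<integral>x. F (truncate J x) \<partial>PiM (low_idx J) R)"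
proof -
  interpret PP: product_prob_space R wavelet_idx by standard
  have "(\<integral>x. F (truncate J x) \<partial>PiM (low_idx J) R)
      = (\<integral>x. F (truncate J x) \<partial>distr (PiM wavelet_idx R) (PiM (low_idx J) R) (\<lambda>x. restrict x (low_idx J)))"
    by (subst PP.distr_PiM_restrict_finite) (auto simp: low_idx_subset)
  also have "\<dots> = (\<integral>x. F (truncate J (restrict x (low_idx J))) \<partial>PiM wavelet_idx R)"
  proof (rule integral_distr)
    have "sets (PiM (low_idx J) R) = sets (PiM (low_idx J) (\<lambda>_. borel))"
      by (rule sets_PiM_cong) auto
    then show "(\<lambda>x. F (truncate J x)) \<in> borel_measurable (PiM (low_idx J) R)"
      using BL_ball_truncate_measurable[OF assms] by (simp cong: measurable_cong_sets)
  qed (rule measurable_restrict_subset[OF low_idx_subset])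
  finally show ?thesis by (simp add: truncate_restrict)
qed

end

text \<open>The triangle inequality through the truncated test functions: each law contributes
  \<open>\<delta>\<close> plus twice the tail of \<open>B\<close>, and the finite-dimensional
  marginals contribute the L1 distances. The bound is the same for every test function, so it passes
  to the supremum.\<close>

lemma BL_dist_PiM_density_le:
  fixes g p :: "nat \<times> nat \<Rightarrow> real \<Rightarrow> real"
  assumes G: "weighted_laws w (\<lambda>i. density lborel (g i))" and P: "weighted_laws w (\<lambda>i. density lborel (p i))"
    and g: "\<And>i. integrable lborel (g i)" "\<And>i y. 0 \<le> g i y"
    and p: "\<And>i. integrable lborel (p i)" "\<And>i y. 0 \<le> p i y"
    and M0: "AE x in (\<Pi>\<^sub>M i\<in>wavelet_idx. density lborel (g i)). x \<in> M0_space w"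
       "AE x in (\<Pi>\<^sub>M i\<in>wavelet_idx. density lborel (p i)). x \<in> M0_space w"
    and \<delta>: "\<delta> > 0" and B: "summable B"
      "\<And>l. l \<ge> J \<Longrightarrow> coordinate_laws.level_tail (\<lambda>i. density lborel (g i)) l (\<delta> * w l) \<le> B l"
      "\<And>l. l \<ge> J \<Longrightarrow> coordinate_laws.level_tail (\<lambda>i. density lborel (p i)) l (\<delta> * w l) \<le> B l"
  shows "BL_dist (M0_space w) (M_dist w) (law_on_M0 w (\<Pi>\<^sub>M i\<in>wavelet_idx. density lborel (g i)))
      (law_on_M0 w (\<Pi>\<^sub>M i\<in>wavelet_idx. density lborel (p i)))
    \<le> 2 * \<delta> + 4 * (\<Sum>l. B (l + J)) + (\<Sum>i\<in>low_idx J. \<integral>y. \<bar>g i y - p i y\<bar> \<partial>lborel)"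
proof -
  interpret G: weighted_laws w "\<lambda>i. density lborel (g i)" by fact
  interpret P: weighted_laws w "\<lambda>i. density lborel (p i)" by fact
  show ?thesis
    unfolding BL_dist_def G.BL_ball_def[symmetric]
  proof (rule cSUP_least)
    show "G.BL_ball \<noteq> {}" using G.zero_in_BL_ball by auto
    fix F assume F: "F \<in> G.BL_ball"
    have "\<bar>(\<integral>x. F (truncate J x) \<partial>PiM (low_idx J) (\<lambda>i. density lborel (g i)))
        - (\<integral>x. F (truncate J x) \<partial>PiM (low_idx J) (\<lambda>i. density lborel (p i)))\<bar>
      \<le> (\<Sum>i\<in>low_idx J. \<integral>y. \<bar>g i y - p i y\<bar> \<partial>lborel)"
      using G.BL_ball_abs_le[OF F] g p
      by (intro integral_PiM_density_diff_le G.BL_ball_truncate_measurable F G.prob_space_R P.prob_space_R) auto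
    moreover note G.truncation_error[where J=J, OF F \<delta> M0(1) B(1,2)] P.truncation_error[where J=J, OF F \<delta> M0(2) B(1,3)]
    ultimately show "\<bar>(\<integral>x. F x \<partial>law_on_M0 w (\<Pi>\<^sub>M i\<in>wavelet_idx. density lborel (g i)))
        - (\<integral>x. F x \<partial>law_on_M0 w (\<Pi>\<^sub>M i\<in>wavelet_idx. density lborel (p i)))\<bar>
      \<le> 2 * \<delta> + 4 * (\<Sum>l. B (l + J)) + (\<Sum>i\<in>low_idx J. \<integral>y. \<bar>g i y - p i y\<bar> \<partial>lborel)"
      unfolding G.integral_law_on_M0[OF F G.sets_PiM_R] P.integral_law_on_M0[OF F P.sets_PiM_R]
        G.integral_truncate[OF F] P.integral_truncate[OF F]
      by linarith
  qed
qed

section \<open>The posterior of one coordinate\<close>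

text \<open>The Gaussian exponent is split in halves: one factor \<open>exp (- u^2 / 4)\<close> pays
  for the tail, the other is a multiple of the normal density of variance 2, whose integral is
  1.\<close>

lemma std_normal_density_le_tail:
  "std_normal_density u * indicator {u. M < \<bar>u\<bar>} u \<le> exp (- M\<^sup>2 / 4) * (2 * normal_density 0 (sqrt 2) u)"
  if "M \<ge> 0" for u M :: real
proof (cases "M < \<bar>u\<bar>")
  case True
  have "std_normal_density u = exp (- u\<^sup>2 / 4) * (sqrt 2 * normal_density 0 (sqrt 2) u)"
    by (simp add: normal_density_def real_sqrt_mult field_simps flip: exp_add)
  also have "\<dots> \<le> exp (- M\<^sup>2 / 4) * (2 * normal_density 0 (sqrt 2) u)"
  proof (intro mult_mono)
    have "M\<^sup>2 \<le> \<bar>u\<bar>\<^sup>2" using True that by (intro power_mono) auto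
    then show "exp (- u\<^sup>2 / 4) \<le> exp (- M\<^sup>2 / 4)" by simp
    show "sqrt 2 \<le> (2::real)" by (rule real_le_lsqrt) auto
  qed auto
  finally show ?thesis using True by simp
qed auto

lemma integral_std_normal_tail_le:
  assumes M: "M \<ge> 0"
    and f: "f \<in> borel_measurable borel" "\<And>u. 0 \<le> f u" "\<And>u. f u \<le> C * std_normal_density u"
  shows "measure (density lborel (\<lambda>u. ennreal (f u))) {u. M < \<bar>u\<bar>} \<le> 2 * C * exp (- M\<^sup>2 / 4)"
proof -
  note [measurable] = f(1)
  have int: "integrable lborel f"
  proof (rule Bochner_Integration.integrable_bound)
    show "integrable lborel (\<lambda>u. C * std_normal_density u)" by simp
    show "AE u in lborel. norm (f u) \<le> norm (C * std_normal_density u)"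
      using f(2,3) by (intro AE_I2) (simp add: order_trans[OF _ abs_ge_self])
  qed auto
  \<comment> \<open>The sign of \<open>C\<close> follows from the domination at
    \<open>u = 0\<close>, where the normal density is positive.\<close>
  have C: "C \<ge> 0"
    using order_trans[OF f(2) f(3), of 0] normal_density_pos[of 1 0 0]
    by (auto simp: zero_le_mult_iff)
  have "emeasure (density lborel (\<lambda>u. ennreal (f u))) {u. M < \<bar>u\<bar>}
      = (\<integral>\<^sup>+u. ennreal (f u * indicator {u. M < \<bar>u\<bar>} u) \<partial>lborel)"
    by (subst emeasure_density) (auto intro!: nn_integral_cong split: split_indicator)
  also have "\<dots> = ennreal (\<integral>u. f u * indicator {u. M < \<bar>u\<bar>} u \<partial>lborel)"
    using int f(2) by (intro nn_integral_eq_integral integrable_real_mult_indicator) auto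
  finally have "measure (density lborel (\<lambda>u. ennreal (f u))) {u. M < \<bar>u\<bar>}
      = (\<integral>u. f u * indicator {u. M < \<bar>u\<bar>} u \<partial>lborel)"
    using f(2) by (simp add: measure_def)
  also have "\<dots> \<le> (\<integral>u. C * (exp (- M\<^sup>2 / 4) * (2 * normal_density 0 (sqrt 2) u)) \<partial>lborel)"
  proof (rule integral_mono)
    show "integrable lborel (\<lambda>u. f u * indicator {u. M < \<bar>u\<bar>} u)"
      using int by (intro integrable_real_mult_indicator) auto
    show "f u * indicator {u. M < \<bar>u\<bar>} u \<le> C * (exp (- M\<^sup>2 / 4) * (2 * normal_density 0 (sqrt 2) u))" for u
    proof -
      have "f u * indicator {u. M < \<bar>u\<bar>} u \<le> C * (std_normal_density u * indicator {u. M < \<bar>u\<bar>} u)"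
        using f(3)[of u] by (auto split: split_indicator)
      also have "\<dots> \<le> C * (exp (- M\<^sup>2 / 4) * (2 * normal_density 0 (sqrt 2) u))"
        using C by (intro mult_left_mono std_normal_density_le_tail M)
      finally show ?thesis .
    qed
  qed auto
  also have "\<dots> = 2 * C * exp (- M\<^sup>2 / 4)"
    by (simp add: integral_normal_density)
  finally show ?thesis .
qed

section \<open>Rescaled posterior densities for a bounded unimodal prior\<close>

locale bounded_unimodal =
  fixes h :: "real \<Rightarrow> real" and H :: real
  assumes measurable_h [measurable]: "h \<in> borel_measurable borel"
    and sym: "h (- x) = h x"
    and pos: "h x > 0"
    and le_H: "h x \<le> H"
    and decreasing: "0 \<le> x \<Longrightarrow> x \<le> y \<Longrightarrow> h y \<le> h x"
begin

lemma h_abs: "h \<bar>x\<bar> = h x"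
  by (cases "x \<ge> 0") (auto simp: sym)

lemma h_mono_abs: "\<bar>x\<bar> \<le> y \<Longrightarrow> h y \<le> h x"
  using decreasing[of "\<bar>x\<bar>" y] by (simp add: h_abs)

lemma H_pos: "H > 0"
  using pos[of 0] le_H[of 0] by linarith

text \<open>In the variable \<open>u = sqrt n * (\<theta> - x)\<close> the likelihood is
  proportional to the standard normal density, and the prior factor is \<open>h\<close> at the
  corresponding \<open>\<theta> / s\<close>.\<close>

definition post_weight :: "nat \<Rightarrow> real \<Rightarrow> real \<Rightarrow> real \<Rightarrow> real" where
  "post_weight n s x u = std_normal_density u * h ((x + u / sqrt (real n)) / s)"

definition post_mass :: "nat \<Rightarrow> real \<Rightarrow> real \<Rightarrow> real" where
  "post_mass n s x = (\<integral>u. post_weight n s x u \<partial>lborel)"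

definition post_density :: "nat \<Rightarrow> real \<Rightarrow> real \<Rightarrow> real \<Rightarrow> real" where
  "post_density n s x u = post_weight n s x u / post_mass n s x"

lemma post_weight_pos: "post_weight n s x u > 0"
  by (simp add: post_weight_def pos normal_density_pos)

lemma post_weight_le: "post_weight n s x u \<le> H * std_normal_density u"
  unfolding post_weight_def by (subst mult.commute) (intro mult_right_mono le_H normal_density_nonneg)

lemma measurable_post_weight [measurable]:
  "(\<lambda>(x, u). post_weight n s x u) \<in> borel_measurable (borel \<Otimes>\<^sub>M borel)"
  unfolding post_weight_def by measurable

lemma measurable_post_weight1 [measurable]: "post_weight n s x \<in> borel_measurable borel"
  unfolding post_weight_def by measurable

lemma integrable_post_weight: "integrable lborel (post_weight n s x)"
proof (rule Bochner_Integration.integrable_bound)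
  show "integrable lborel (\<lambda>u. H * std_normal_density u)" by simp
  show "AE u in lborel. norm (post_weight n s x u) \<le> norm (H * std_normal_density u)"
    using H_pos post_weight_pos[of n s x] post_weight_le[of n s x]
    by (intro AE_I2) (simp add: abs_of_pos less_imp_le)
qed auto

text \<open>Only \<open>[-1, 1]\<close> is kept, whose length is the factor 2. There the normal
  density is at least its value at 1, and since \<open>n \<ge> 1\<close> the argument of
  \<open>h\<close> is at most \<open>(\<bar>x\<bar> + 1) / s\<close> in absolute value, so
  unimodality bounds \<open>h\<close> from below.\<close>

lemma post_mass_ge:
  assumes n: "n > 0" and s: "s > 0"
  shows "post_mass n s x \<ge> 2 * std_normal_density 1 * h ((\<bar>x\<bar> + 1) / s)"
proof -
  let ?c = "std_normal_density 1 * h ((\<bar>x\<bar> + 1) / s)"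
  have "2 * ?c = (\<integral>u. ?c * indicator {-1..1::real} u \<partial>lborel)"
    by simp
  also have "\<dots> \<le> post_mass n s x"
    unfolding post_mass_def
  proof (rule integral_mono)
    fix u :: real
    show "?c * indicator {-1..1} u \<le> post_weight n s x u"
    proof (cases "\<bar>u\<bar> \<le> 1")
      case True
      have "u\<^sup>2 \<le> 1" using True by (simp add: abs_square_le_1)
      then have "std_normal_density 1 \<le> std_normal_density u"
        by (simp add: normal_density_def divide_right_mono)
      moreover have "\<bar>u / sqrt (real n)\<bar> \<le> 1 / 1"
        unfolding abs_divide using True n by (intro frac_le) auto
      then have "\<bar>(x + u / sqrt (real n)) / s\<bar> \<le> (\<bar>x\<bar> + 1) / s"
        using s abs_triangle_ineq[of x "u / sqrt (real n)"]
        by (simp add: abs_divide divide_right_mono)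
      then have "h ((\<bar>x\<bar> + 1) / s) \<le> h ((x + u / sqrt (real n)) / s)"
        by (rule h_mono_abs)
      ultimately have "?c \<le> post_weight n s x u"
        unfolding post_weight_def using pos by (intro mult_mono) (auto simp: less_imp_le)
      then show ?thesis using post_weight_pos[of n s x u] by (auto split: split_indicator)
    next
      case False
      then show ?thesis using post_weight_pos[of n s x u] by (auto split: split_indicator)
    qed
  qed (auto intro: integrable_post_weight integrable_real_mult_indicator)
  finally show ?thesis by simp
qed

lemma post_mass_pos: "n > 0 \<Longrightarrow> s > 0 \<Longrightarrow> post_mass n s x > 0"
  by (rule less_le_trans[OF _ post_mass_ge]) (auto simp: normal_density_pos pos)

lemma measurable_post_mass [measurable]: "post_mass n s \<in> borel_measurable borel"
  unfolding post_mass_def by measurable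

lemma measurable_post_density [measurable]:
  "(\<lambda>(x, u). post_density n s x u) \<in> borel_measurable (borel \<Otimes>\<^sub>M borel)"
  unfolding post_density_def by measurable

lemma measurable_post_density1 [measurable]: "post_density n s x \<in> borel_measurable borel"
  unfolding post_density_def by measurable

lemma post_density_nonneg: "n > 0 \<Longrightarrow> s > 0 \<Longrightarrow> post_density n s x u \<ge> 0"
  using post_weight_pos[of n s x u] post_mass_pos[of n s x] by (simp add: post_density_def less_imp_le)

lemma integrable_post_density: "integrable lborel (post_density n s x)"
  unfolding post_density_def by (intro integrable_divide integrable_post_weight)

lemma integral_post_density: "n > 0 \<Longrightarrow> s > 0 \<Longrightarrow> (\<integral>u. post_density n s x u \<partial>lborel) = 1"
  using post_mass_pos[of n s x] by (simp add: post_density_def post_mass_def)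

lemma prob_space_post_density:
  assumes "n > 0" "s > 0"
  shows "prob_space (density lborel (\<lambda>u. ennreal (post_density n s x u)))"
proof (rule prob_spaceI)
  show "emeasure (density lborel (\<lambda>u. ennreal (post_density n s x u)))
     (space (density lborel (\<lambda>u. ennreal (post_density n s x u)))) = 1"
    using assms integrable_post_density[of n s x] integral_post_density[of n s x]
    by (simp add: emeasure_density nn_integral_eq_integral post_density_nonneg)
qed

lemma coord_posterior_rescaled:
  assumes n: "n > 0" and s: "s > 0"
  shows "distr (coord_posterior n h s x) borel (\<lambda>\<theta>. sqrt (real n) * (\<theta> - x))
    = density lborel (\<lambda>u. ennreal (post_density n s x u))"
proof -
  define r where "r = sqrt (real n)"
  have r: "r > 0" and rn: "real n = r\<^sup>2" using n by (auto simp: r_def)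
  define T where "T = (\<lambda>\<theta>. r * (\<theta> - x))"
  have [measurable]: "T \<in> borel_measurable borel" unfolding T_def by measurable
  define Z where "Z = (\<integral>t. exp (- (real n * (x - t)\<^sup>2) / 2) * h (t / s) \<partial>lborel)"
  define G where "G = (\<lambda>u. exp (- u\<^sup>2 / 2) * h ((x + u / r) / s) / Z)"
  have [measurable]: "G \<in> borel_measurable borel" unfolding G_def by measurable
  have e: "exp (- u\<^sup>2 / 2) = sqrt (2 * pi) * std_normal_density u" for u :: real
    by (simp add: std_normal_density_def)
  \<comment> \<open>Substituting \<open>t = x + u / r\<close> produces the Jacobian
    \<open>1 / r\<close>.\<close>
  have "Z = (1 / r) * (\<integral>u. exp (- u\<^sup>2 / 2) * h ((x + u / r) / s) \<partial>lborel)"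
    unfolding Z_def rn using r
    by (subst lborel_integral_real_affine[of "1 / r" _ x]) (simp_all add: power2_eq_square field_simps)
  also have "(\<integral>u. exp (- u\<^sup>2 / 2) * h ((x + u / r) / s) \<partial>lborel) = sqrt (2 * pi) * post_mass n s x"
    unfolding post_mass_def post_weight_def e r_def
    by (simp add: mult.assoc del: integral_mult_right_zero flip: integral_mult_right_zero)
  finally have Z: "Z = (1 / r) * (sqrt (2 * pi) * post_mass n s x)" .
  \<comment> \<open>\<open>Z\<close> normalises on the scale of \<open>\<theta>\<close>, so
    \<open>G\<close> is \<open>r\<close> times the density on the scale of \<open>u\<close>; the
    image of Lebesgue measure under \<open>T\<close> carries the inverse factor.\<close>
  have G: "G u = r * post_density n s x u" for u
    unfolding G_def Z e post_density_def post_weight_def using r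
    by (simp add: r_def[symmetric] field_simps)
  have "coord_posterior n h s x = density lborel (\<lambda>\<theta>. ennreal (G (T \<theta>)))"
    using n s less_imp_le[OF pos] r
    by (subst coord_posterior_eq)
      (auto simp: G_def T_def Z_def rn power_mult_distrib power2_commute intro!: arg_cong[where f="density lborel"])
  then have "distr (coord_posterior n h s x) borel T = density (distr lborel borel T) (\<lambda>u. ennreal (G u))"
    by (simp add: density_distr)
  also have "distr lborel borel T = distr (distr lborel borel ((+) (- x))) borel ((*) r)"
    by (subst distr_distr) (auto simp: T_def comp_def)
  also have "\<dots> = density lborel (\<lambda>_. ennreal (inverse r))"
    using r by (simp add: lborel_distr_plus lborel_distr_mult)
  also have "density \<dots> (\<lambda>u. ennreal (G u)) = density lborel (\<lambda>u. ennreal (post_density n s x u))"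
    using r n s by (subst density_density_eq)
      (auto simp: G ennreal_mult''[symmetric] post_density_nonneg mult.assoc[symmetric])
  finally show ?thesis by (simp add: T_def r_def)
qed

text \<open>The numerator is at most \<open>H\<close> times the normal density and the normaliser is
  bounded by \<open>post_mass_ge\<close>. The prior then enters through \<open>H\<close> and
  \<open>1 / h\<close> at a single point, with no further dependence on \<open>n\<close>.\<close>

lemma post_density_tail:
  assumes n: "n > 0" and s: "s > 0" and M: "M \<ge> 0"
  shows "measure (density lborel (\<lambda>u. ennreal (post_density n s x u))) {u. M < \<bar>u\<bar>}
    \<le> H / std_normal_density 1 * exp (- M\<^sup>2 / 4) / h ((\<bar>x\<bar> + 1) / s)"
proof -
  let ?m = "2 * std_normal_density 1 * h ((\<bar>x\<bar> + 1) / s)"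
  have m: "?m > 0" using pos normal_density_pos[of 1 0 1] by simp
  have "post_density n s x u \<le> (H / ?m) * std_normal_density u" for u
  proof -
    have "post_density n s x u \<le> (H * std_normal_density u) / ?m"
      unfolding post_density_def
      using post_weight_le[of n s x u] post_mass_ge[OF n s, of x] m post_weight_pos[of n s x u]
      by (intro frac_le) (auto simp: less_imp_le)
    then show ?thesis by simp
  qed
  then have "measure (density lborel (\<lambda>u. ennreal (post_density n s x u))) {u. M < \<bar>u\<bar>}
      \<le> 2 * (H / ?m) * exp (- M\<^sup>2 / 4)"
    by (intro integral_std_normal_tail_le M) (auto simp: post_density_nonneg n s)
  also have "\<dots> = H / std_normal_density 1 * exp (- M\<^sup>2 / 4) / h ((\<bar>x\<bar> + 1) / s)"
    by simp
  finally show ?thesis .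
qed

text \<open>Monotonicity gives a right limit, the supremum over positive arguments, and symmetry
  gives the same left limit. The value \<open>h 0\<close> may be larger, so the supremum leaves it
  out and the limit is a punctured one.\<close>

lemma has_limit_at_0: "\<exists>v>0. (h \<longlongrightarrow> v) (at 0)"
proof -
  define v where "v = (SUP x\<in>{0<..}. h x)"
  have bdd: "bdd_above (h ` {0<..})" using le_H by (auto intro!: bdd_aboveI2)
  have "h 1 \<le> v" unfolding v_def by (rule cSUP_upper) (use bdd in auto)
  then have v: "v > 0" using pos[of 1] by simp
  have "(h \<longlongrightarrow> v) (at 0)"
  proof (rule tendstoI)
    fix e :: real assume "e > 0"
    then have "\<exists>x\<in>{0<..}. v - e < h x"
      unfolding v_def by (subst less_cSUP_iff[symmetric]) (use bdd in auto)
    then obtain x where x: "x > 0" "v - e < h x" by auto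
    show "\<forall>\<^sub>F y in at 0. dist (h y) v < e"
      unfolding eventually_at
    proof (intro exI[of _ x] conjI ballI impI)
      fix y :: real assume y: "y \<noteq> 0 \<and> dist y 0 < x"
      have "h x \<le> h y" by (rule h_mono_abs) (use y in simp)
      moreover have "h \<bar>y\<bar> \<le> v" unfolding v_def by (rule cSUP_upper) (use bdd y in auto)
      ultimately show "dist (h y) v < e" using x \<open>e > 0\<close> by (simp add: h_abs dist_real_def)
    qed (use x in auto)
  qed
  then show ?thesis using v by auto
qed

text \<open>A positive limit of \<open>h\<close> at the true value makes the prior asymptotically
  flat: the weights converge to \<open>v\<close> times the normal density, dominated convergence
  sends the masses to \<open>v\<close>, and Scheffe's lemma upgrades the convergence of the
  quotients to L1.\<close>

lemma post_density_tendsto: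
  assumes s: "s > 0" and v: "v > 0" "(h \<longlongrightarrow> v) (at (\<theta> / s))"
  shows "(\<lambda>n. \<integral>u. \<bar>post_density (Suc n) s (\<theta> + z / sqrt (real (Suc n))) u - std_normal_density u\<bar> \<partial>lborel)
    \<longlonglongrightarrow> 0"
proof -
  define W where "W = (\<lambda>n u. post_weight (Suc n) s (\<theta> + z / sqrt (real (Suc n))) u)"
  define m where "m = (\<lambda>n. post_mass (Suc n) s (\<theta> + z / sqrt (real (Suc n))))"
  have [measurable]: "W n \<in> borel_measurable borel" for n unfolding W_def by measurable
  have lim: "AE u in lborel. (\<lambda>n. W n u) \<longlonglongrightarrow> std_normal_density u * v"
  proof -
    \<comment> \<open>Since the limit of \<open>h\<close> is punctured, the arguments must avoid
      \<open>\<theta> / s\<close> itself; this excludes a single \<open>u\<close>.\<close>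
    have "AE u in lborel. u \<noteq> - z" by (rule AE_lborel_singleton)
    then show ?thesis
    proof eventually_elim
      fix u assume u: "u \<noteq> - z"
      have "(\<lambda>n. 1 / sqrt (real (Suc n))) \<longlonglongrightarrow> 0"
        using tendsto_real_sqrt[OF LIMSEQ_inverse_real_of_nat]
        by (simp add: real_sqrt_inverse inverse_eq_divide real_sqrt_divide)
      then have "(\<lambda>n. \<theta> / s + (z + u) / s * (1 / sqrt (real (Suc n)))) \<longlonglongrightarrow> \<theta> / s + (z + u) / s * 0"
        by (intro tendsto_intros)
      moreover have "\<forall>\<^sub>F n in sequentially. \<theta> / s + (z + u) / s * (1 / sqrt (real (Suc n))) \<noteq> \<theta> / s"
        using u s by (intro always_eventually allI) (auto simp: add_eq_0_iff)
      ultimately have "filterlim (\<lambda>n. \<theta> / s + (z + u) / s * (1 / sqrt (real (Suc n)))) (at (\<theta> / s)) sequentially"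
        by (auto simp: filterlim_at)
      from filterlim_compose[OF v(2) this]
      have "(\<lambda>n. h ((\<theta> + z / sqrt (real (Suc n)) + u / sqrt (real (Suc n))) / s)) \<longlonglongrightarrow> v"
        by (simp add: add_divide_distrib add.assoc mult.commute)
      then show "(\<lambda>n. W n u) \<longlonglongrightarrow> std_normal_density u * v"
        unfolding W_def post_weight_def by (intro tendsto_intros)
    qed
  qed
  have "(\<lambda>n. \<integral>u. W n u \<partial>lborel) \<longlonglongrightarrow> (\<integral>u. std_normal_density u * v \<partial>lborel)"
  proof (rule integral_dominated_convergence[where w = "\<lambda>u. H * std_normal_density u"])
    show "AE u in lborel. norm (W n u) \<le> H * std_normal_density u" for n
      using post_weight_le post_weight_pos unfolding W_def by (intro AE_I2) (simp add: abs_of_pos)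
  qed (use lim in auto)
  then have m: "m \<longlonglongrightarrow> v" by (simp add: m_def post_mass_def W_def)
  \<comment> \<open>Scheffe's lemma asks that the approximating masses not exceed the limiting one;
    here all of them equal 1.\<close>
  have "(\<lambda>n. \<integral>\<^sup>+u. norm (W n u / m n - std_normal_density u) \<partial>lborel) \<longlonglongrightarrow> 0"
  proof (rule Scheffe_lemma2)
    show "AE u in lborel. (\<lambda>n. W n u / m n) \<longlonglongrightarrow> std_normal_density u"
      using lim
    proof eventually_elim
      fix u assume "(\<lambda>n. W n u) \<longlonglongrightarrow> std_normal_density u * v"
      from tendsto_divide[OF this m] v show "(\<lambda>n. W n u / m n) \<longlonglongrightarrow> std_normal_density u" by simp
    qed
    show "(\<integral>\<^sup>+u. norm (W n u / m n) \<partial>lborel) \<le> (\<integral>\<^sup>+u. norm (std_normal_density u) \<partial>lborel)" for n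
    proof -
      have "(\<integral>\<^sup>+u. norm (W n u / m n) \<partial>lborel) = (\<integral>\<^sup>+u. post_density (Suc n) s (\<theta> + z / sqrt (real (Suc n))) u \<partial>lborel)"
        using post_density_nonneg[of "Suc n" s "\<theta> + z / sqrt (real (Suc n))"] s
        unfolding W_def m_def post_density_def[symmetric]
        by (intro nn_integral_cong) (simp del: of_nat_Suc)
      also have "\<dots> = 1"
        using s post_density_nonneg[of "Suc n" s]
        by (subst nn_integral_eq_integral[OF integrable_post_density]) (auto simp: integral_post_density)
      also have "\<dots> = (\<integral>\<^sup>+u. norm (std_normal_density u) \<partial>lborel)"
        by (subst nn_integral_eq_integral) (auto simp: integral_normal_density)
      finally show ?thesis by simp
    qed
  qed auto
  then have "(\<lambda>n. enn2real (\<integral>\<^sup>+u. norm (W n u / m n - std_normal_density u) \<partial>lborel)) \<longlonglongrightarrow> enn2real 0"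
    by (intro tendsto_enn2real) auto
  moreover have "enn2real (\<integral>\<^sup>+u. norm (W n u / m n - std_normal_density u) \<partial>lborel)
     = (\<integral>u. \<bar>post_density (Suc n) s (\<theta> + z / sqrt (real (Suc n))) u - std_normal_density u\<bar> \<partial>lborel)" for n
    by (subst integral_eq_nn_integral) (auto simp: W_def m_def post_density_def)
  ultimately show ?thesis by simp
qed

end

section \<open>White noise and measurability of the distance\<close>

text \<open>A kernel into probability measures can be tested on cylinders, an intersection-stable
  generator. There the mass is a finite product of one-dimensional integrals, each measurable in one
  coordinate of the parameter.\<close>

lemma measurable_PiM_density:
  fixes f :: "'i \<Rightarrow> real \<Rightarrow> real \<Rightarrow> real"
  assumes f: "\<And>i. i \<in> I \<Longrightarrow> (\<lambda>(x, u). f i x u) \<in> borel_measurable (borel \<Otimes>\<^sub>M borel)"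
    and prob: "\<And>i x. i \<in> I \<Longrightarrow> prob_space (density lborel (f i x))"
  shows "(\<lambda>X. \<Pi>\<^sub>M i\<in>I. density lborel (f i (X i))) \<in> (\<Pi>\<^sub>M i\<in>I. borel) \<rightarrow>\<^sub>M prob_algebra (\<Pi>\<^sub>M i\<in>I. borel)"
proof (rule measurable_prob_algebra_generated[OF sets_PiM Int_stable_prod_algebra prod_algebra_sets_into_space])
  fix X :: "'i \<Rightarrow> real"
  show "prob_space (\<Pi>\<^sub>M i\<in>I. density lborel (f i (X i)))"
    using prob by (rule prob_space_PiM)
  show "sets (\<Pi>\<^sub>M i\<in>I. density lborel (f i (X i))) = sets (\<Pi>\<^sub>M i\<in>I. borel)"
    by (rule sets_PiM_cong) auto
next
  fix A :: "('i \<Rightarrow> real) set" assume "A \<in> prod_algebra I (\<lambda>_. borel)"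
  then obtain J E where A: "A = prod_emb I (\<lambda>_. borel) J (Pi\<^sub>E J E)" "finite J" "J \<subseteq> I"
    and E: "\<And>i. i \<in> J \<Longrightarrow> E i \<in> sets borel"
    by (elim prod_algebraE) auto
  have "emeasure (\<Pi>\<^sub>M i\<in>I. density lborel (f i (X i))) A
      = (\<Prod>i\<in>J. \<integral>\<^sup>+u. ennreal (f i (X i) u) * indicator (E i) u \<partial>lborel)" for X
  proof -
    have "f i x \<in> borel_measurable borel" if "i \<in> I" for i x
      using measurable_Pair2[OF f[OF that], of x] by simp
    moreover have "A = prod_emb I (\<lambda>i. density lborel (f i (X i))) J (Pi\<^sub>E J E)"
      unfolding A by (simp add: prod_emb_def)
    ultimately show ?thesis
      using A prob E by (simp add: emeasure_PiM_emb emeasure_density subset_eq)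
  qed
  moreover have "(\<lambda>X. \<integral>\<^sup>+u. ennreal (f i (X i) u) * indicator (E i) u \<partial>lborel) \<in> borel_measurable (\<Pi>\<^sub>M i\<in>I. borel)"
    if i: "i \<in> J" for i
  proof -
    have iI: "i \<in> I" using i A by auto
    note [measurable] = f[OF iI] E[OF i]
    have "(\<lambda>x. \<integral>\<^sup>+u. ennreal (f i x u) * indicator (E i) u \<partial>lborel) \<in> borel_measurable borel"
      by measurable
    from measurable_compose[OF measurable_component_singleton[OF iI] this] show ?thesis .
  qed
  ultimately show "(\<lambda>X. emeasure (\<Pi>\<^sub>M i\<in>I. density lborel (f i (X i))) A) \<in> borel_measurable (\<Pi>\<^sub>M i\<in>I. borel)"
    by (simp add: borel_measurable_prod)
qed

section \<open>Coupling the data with one white noise\<close>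

lemma distr_std_normal_affine:
  assumes "\<sigma> > 0"
  shows "distr (density lborel std_normal_density) borel (\<lambda>z. m + \<sigma> * z) = density lborel (normal_density m \<sigma>)"
proof -
  interpret prob_space "density lborel std_normal_density"
    by (rule prob_space_normal_density) simp
  have "distributed (density lborel std_normal_density) lborel (\<lambda>x. x) std_normal_density"
    by (auto simp: distributed_def distr_id2 cong: distr_cong)
  from normal_density_affine[OF this, of \<sigma> m] assms
  have "distributed (density lborel std_normal_density) lborel (\<lambda>x. m + \<sigma> * x) (normal_density m \<sigma>)"
    by simp
  then show ?thesis by (auto simp: distributed_def cong: distr_cong)
qed

text \<open>One noise sequence \<open>z\<close> generates the data for every \<open>n\<close>, so
  that limits in \<open>n\<close> can be taken with the noise held fixed.\<close>

definition shift_noise :: "nat \<Rightarrow> (nat \<times> nat \<Rightarrow> real) \<Rightarrow> (nat \<times> nat \<Rightarrow> real) \<Rightarrow> nat \<times> nat \<Rightarrow> real" where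
  "shift_noise n f z = (\<lambda>i\<in>wavelet_idx. f i + 1 / sqrt (real n) * z i)"

lemma measurable_shift_noise [measurable]: "shift_noise n f \<in> coeff_space \<rightarrow>\<^sub>M coeff_space"
  unfolding shift_noise_def by (intro measurable_restrict) (simp add: measurable_coeff)

lemma sets_white_noise [measurable_cong]: "sets white_noise = sets coeff_space"
  unfolding white_noise_def by (rule sets_PiM_cong) auto

lemma data_law_eq_distr:
  assumes "n > 0"
  shows "data_law n f = distr white_noise coeff_space (shift_noise n f)"
proof -
  have "distr white_noise coeff_space (shift_noise n f)
      = (\<Pi>\<^sub>M i\<in>wavelet_idx. distr (density lborel std_normal_density) borel (\<lambda>z. f i + 1 / sqrt (real n) * z))"
    unfolding white_noise_def shift_noise_def
    by (rule distr_PiM_coordinatewise) (auto simp: prob_space_normal_density)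
  also have "\<dots> = data_law n f"
    unfolding data_law_def using assms by (intro PiM_cong refl distr_std_normal_affine) auto
  finally show ?thesis ..
qed

global_interpretation noise: coordinate_laws "\<lambda>_. density lborel std_normal_density"
  by (simp add: coordinate_laws_def prob_space_normal_density)

section \<open>Summable tails of white noise\<close>

lemma noise_level_tail_le:
  assumes "M \<ge> 0"
  shows "noise.level_tail l M \<le> 2 ^ l * (2 * exp (- M\<^sup>2 / 4))"
proof -
  have "noise.level_tail l M \<le> (\<Sum>k<(2::nat) ^ l. 2 * 1 * exp (- M\<^sup>2 / 4))"
    unfolding noise.level_tail_def by (intro sum_mono integral_std_normal_tail_le assms) auto
  then show ?thesis by simp
qed

text \<open>Eventually \<open>(K + 2) * r l powr p\<close> is at most
  \<open>\<delta> * (w l)^2\<close>, so the exponent is at most \<open>- 2 * r l powr p\<close>,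
  hence at most \<open>- 2 * l\<close>. The ratio \<open>2 * exp (- 2) < 1\<close> then absorbs the
  \<open>2 ^ l\<close> coefficients.\<close>

lemma summable_level_bound:
  fixes r w :: "nat \<Rightarrow> real"
  assumes w: "\<And>l. w l > 0" and r: "\<And>l. real l \<le> r l" and p: "p \<ge> 1"
    and growth: "(\<lambda>l. r l powr p / (w l)\<^sup>2) \<longlonglongrightarrow> 0"
    and "K \<ge> 0" "\<delta> > 0" "C \<ge> 0"
  shows "summable (\<lambda>l. 2 ^ l * (C * exp (K * r l powr p - \<delta> * (w l)\<^sup>2)))"
proof (rule summable_comparison_test_ev)
  have "(2::real) * exp (- 2) < 1"
  proof -
    have "3 \<le> exp (2::real)" using exp_ge_add_one_self[of "2::real"] by simp
    then show ?thesis by (simp add: exp_minus field_simps)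
  qed
  then show "summable (\<lambda>l. C * (2 * exp (- 2)) ^ l)"
    by (intro summable_mult summable_geometric) auto
  have "\<forall>\<^sub>F l in sequentially. r l powr p / (w l)\<^sup>2 < \<delta> / (K + 2)"
    using growth \<open>K \<ge> 0\<close> \<open>\<delta> > 0\<close> by (intro order_tendstoD) auto
  then show "\<forall>\<^sub>F l in sequentially. norm (2 ^ l * (C * exp (K * r l powr p - \<delta> * (w l)\<^sup>2)))
      \<le> C * (2 * exp (- 2)) ^ l"
    using eventually_ge_at_top[of 1]
  proof eventually_elim
    case (elim l)
    have r1: "1 \<le> r l" using r[of l] elim(2) by simp
    have "real l \<le> r l powr 1" using r[of l] r1 by simp
    also have "\<dots> \<le> r l powr p" using r1 p by (intro powr_mono)
    finally have l: "real l \<le> r l powr p" .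
    have "(K + 2) * r l powr p \<le> \<delta> * (w l)\<^sup>2"
      using elim(1) w[of l] \<open>K \<ge> 0\<close> by (simp add: field_simps)
    then have "K * r l powr p - \<delta> * (w l)\<^sup>2 \<le> real l * (- 2)"
      using l by (simp add: algebra_simps)
    then have "exp (K * r l powr p - \<delta> * (w l)\<^sup>2) \<le> exp (- 2) ^ l"
      by (simp flip: exp_of_nat_mult)
    then have "2 ^ l * (C * exp (K * r l powr p - \<delta> * (w l)\<^sup>2)) \<le> 2 ^ l * (C * exp (- 2) ^ l)"
      using \<open>C \<ge> 0\<close> by (intro mult_left_mono) auto
    then show ?case using \<open>C \<ge> 0\<close> by (simp add: power_mult_distrib mult.left_commute)
  qed
qed

lemma noise_tail_summable:
  fixes r w :: "nat \<Rightarrow> real"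
  assumes w: "\<And>l. w l > 0" and r: "\<And>l. real l \<le> r l" and p: "p \<ge> 1"
    and growth: "(\<lambda>l. r l powr p / (w l)\<^sup>2) \<longlonglongrightarrow> 0" and "\<delta> > 0"
  shows "summable (\<lambda>l. noise.level_tail l (\<delta> * w l))"
proof (rule summable_comparison_test')
  show "summable (\<lambda>l. 2 ^ l * (2 * exp (0 * r l powr p - \<delta>\<^sup>2 / 4 * (w l)\<^sup>2)))"
    using \<open>\<delta> > 0\<close> by (intro summable_level_bound w r p growth) auto
  show "norm (noise.level_tail l (\<delta> * w l)) \<le> 2 ^ l * (2 * exp (0 * r l powr p - \<delta>\<^sup>2 / 4 * (w l)\<^sup>2))"
    if "l \<ge> 0" for l
    using noise_level_tail_le[of "\<delta> * w l" l] noise.level_tail_nonneg[of l "\<delta> * w l"] \<open>\<delta> > 0\<close> w[of l]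
    by (simp add: power_mult_distrib)
qed

lemma AE_white_noise_in_M0:
  fixes r w :: "nat \<Rightarrow> real"
  assumes w: "\<And>l. w l > 0" and r: "\<And>l. real l \<le> r l" and p: "p \<ge> 1"
    and growth: "(\<lambda>l. r l powr p / (w l)\<^sup>2) \<longlonglongrightarrow> 0"
  shows "AE x in white_noise. x \<in> M0_space w"
proof -
  interpret N: weighted_laws w "\<lambda>_. density lborel std_normal_density"
    by (simp add: weighted_laws_def weights_def w noise.coordinate_laws_axioms)
  show ?thesis
    unfolding white_noise_def by (rule N.AE_in_M0) (rule noise_tail_summable[OF assms])
qed

text \<open>Membership in the multiscale space with the auxiliary weights \<open>l + 1\<close>:
  ratios tending to 0 are eventually below 1. The bound will control the data in the posterior
  tails.\<close>

lemma AE_white_noise_le_linear: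
  "AE z in white_noise. \<exists>N. \<forall>l\<ge>N. level_max z l \<le> real l + 1"
proof -
  let ?w = "\<lambda>l::nat. real l + 1"
  interpret weights ?w by standard simp
  have "(\<lambda>l. inverse (real (Suc l))) \<longlonglongrightarrow> 0" by (rule LIMSEQ_inverse_real_of_nat)
  then have "(\<lambda>l. real l powr 1 / (real l + 1)\<^sup>2) \<longlonglongrightarrow> 0"
  proof (rule Lim_null_comparison[rotated])
    show "\<forall>\<^sub>F l in sequentially. norm (real l powr 1 / (real l + 1)\<^sup>2) \<le> inverse (real (Suc l))"
    proof (intro always_eventually allI)
      fix l :: nat
      have "norm (real l powr 1 / (real l + 1)\<^sup>2) \<le> (real l + 1) / (real l + 1)\<^sup>2"
        by (simp add: divide_right_mono)
      then show "norm (real l powr 1 / (real l + 1)\<^sup>2) \<le> inverse (real (Suc l))"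
        by (simp add: power2_eq_square divide_inverse add.commute)
    qed
  qed
  then have "AE z in white_noise. z \<in> M0_space ?w"
    by (intro AE_white_noise_in_M0[where r = real and p = 1]) auto
  then show ?thesis
  proof eventually_elim
    case (elim z)
    then have "(\<lambda>l. level_max z l / (real l + 1)) \<longlonglongrightarrow> 0" by (simp add: M0_space_iff)
    then have "\<forall>\<^sub>F l in sequentially. level_max z l / (real l + 1) < 1"
      by (rule order_tendstoD) simp
    then show ?case by (auto simp: eventually_sequentially field_simps intro: less_imp_le)
  qed
qed

section \<open>Range and measurability of the bounded-Lipschitz distance\<close>

context weights
begin

lemma integral_law_on_M0_abs_le:
  assumes F: "F \<in> BL_ball" and Q: "prob_space Q" "sets Q = sets coeff_space"
  shows "\<bar>\<integral>x. F x \<partial>law_on_M0 w Q\<bar> \<le> 1"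
proof -
  interpret Q: prob_space Q by fact
  interpret weighted_laws w "\<lambda>_. density lborel std_normal_density" by (simp add: weighted_laws_def weights_axioms noise.coordinate_laws_axioms)
  have "F \<circ> into_M0 \<in> borel_measurable Q"
    using measurable_BL_ball_into_M0[OF F] Q(2) by (simp cong: measurable_cong_sets add: comp_def)
  then have "integrable Q (\<lambda>x. F (into_M0 x))"
    using BL_ball_abs_le[OF F] by (intro Q.integrable_const_bound[where B=1]) (auto simp: comp_def)
  then have "(\<integral>x. \<bar>F (into_M0 x)\<bar> \<partial>Q) \<le> (\<integral>x. 1 \<partial>Q)"
    using BL_ball_abs_le[OF F] by (intro integral_mono) auto
  moreover have "\<bar>\<integral>x. F (into_M0 x) \<partial>Q\<bar> \<le> (\<integral>x. \<bar>F (into_M0 x)\<bar> \<partial>Q)"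
    by (rule Bochner_Integration.integral_abs_bound)
  moreover have "(\<integral>x. 1 \<partial>Q) = (1 :: real)" by (simp add: Q.prob_space)
  ultimately show ?thesis
    unfolding integral_law_on_M0[OF F Q(2)] by linarith
qed

lemma BL_diff_le_2:
  assumes F: "F \<in> BL_ball" and "prob_space P" "sets P = sets coeff_space" "prob_space Q" "sets Q = sets coeff_space"
  shows "\<bar>(\<integral>x. F x \<partial>law_on_M0 w P) - (\<integral>x. F x \<partial>law_on_M0 w Q)\<bar> \<le> 2"
  using integral_law_on_M0_abs_le[OF F assms(2,3)] integral_law_on_M0_abs_le[OF F assms(4,5)] by linarith

lemma BL_dist_bounds:
  assumes "prob_space P" "sets P = sets coeff_space" "prob_space Q" "sets Q = sets coeff_space"
  shows "BL_dist (M0_space w) (M_dist w) (law_on_M0 w P) (law_on_M0 w Q) \<in> {0..2}"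
proof -
  let ?f = "\<lambda>F. \<bar>(\<integral>x. F x \<partial>law_on_M0 w P) - (\<integral>x. F x \<partial>law_on_M0 w Q)\<bar>"
  have "bdd_above (?f ` BL_ball)" using BL_diff_le_2[OF _ assms] by (auto intro!: bdd_aboveI2)
  from cSUP_upper2[OF this zero_in_BL_ball, of 0]
  have "0 \<le> (SUP F\<in>BL_ball. ?f F)" by simp
  moreover have "(SUP F\<in>BL_ball. ?f F) \<le> 2"
    using zero_in_BL_ball BL_diff_le_2[OF _ assms] by (intro cSUP_least) auto
  ultimately show ?thesis unfolding BL_dist_def BL_ball_def[symmetric] by simp
qed

text \<open>The supremum over uncountably many test functions equals the one over the countable
  family of \<open>BL_ball_separable\<close>, because pointwise limits of functions bounded by 1
  pass under the integral.\<close>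

lemma measurable_BL_dist:
  assumes K: "K \<in> M \<rightarrow>\<^sub>M prob_algebra coeff_space" and Q: "prob_space Q" "sets Q = sets coeff_space"
  shows "(\<lambda>X. BL_dist (M0_space w) (M_dist w) (law_on_M0 w (K X)) (law_on_M0 w Q)) \<in> borel_measurable M"
proof -
  interpret weighted_laws w "\<lambda>_. density lborel std_normal_density" by (simp add: weighted_laws_def weights_axioms noise.coordinate_laws_axioms)
  interpret Q: prob_space Q by fact
  let ?f = "\<lambda>F X. \<bar>(\<integral>x. F x \<partial>law_on_M0 w (K X)) - (\<integral>x. F x \<partial>law_on_M0 w Q)\<bar>"
  obtain C where C: "countable C" "C \<subseteq> BL_ball" "C \<noteq> {}"
    "\<And>F. F \<in> BL_ball \<Longrightarrow> \<exists>G. (\<forall>n. G n \<in> C) \<and> (\<forall>x\<in>M0_space w. (\<lambda>n::nat. G n x) \<longlonglongrightarrow> F x)"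
    using BL_ball_separable by blast
  have KX: "prob_space (K X)" "sets (K X) = sets coeff_space" if "X \<in> space M" for X
    using measurable_space[OF K that] by (auto simp: space_prob_algebra)
  have bdd: "bdd_above ((\<lambda>F. ?f F X) ` A)" if "X \<in> space M" "A \<subseteq> BL_ball" for A X
    using BL_diff_le_2[OF _ KX[OF that(1)] Q] that(2) by (auto intro!: bdd_aboveI2)
  have lim: "(\<lambda>n. \<integral>x. G n x \<partial>law_on_M0 w P) \<longlonglongrightarrow> (\<integral>x. F x \<partial>law_on_M0 w P)"
    if F: "F \<in> BL_ball" and G: "\<And>n::nat. G n \<in> BL_ball" "\<And>x. x \<in> M0_space w \<Longrightarrow> (\<lambda>n. G n x) \<longlonglongrightarrow> F x"
      and P: "prob_space P" "sets P = sets coeff_space" for F G P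
    unfolding integral_law_on_M0[OF F P(2)] integral_law_on_M0[OF G(1) P(2)]
  proof (rule integral_dominated_convergence[where w = "\<lambda>_. 1"])
    interpret Pr: prob_space P by fact
    show "integrable P (\<lambda>_. 1 :: real)" by simp
    show "(\<lambda>x. F (into_M0 x)) \<in> borel_measurable P" "(\<lambda>x. G n (into_M0 x)) \<in> borel_measurable P" for n
      using measurable_BL_ball_into_M0[OF F] measurable_BL_ball_into_M0[OF G(1)[of n]] P(2)
      by (simp_all cong: measurable_cong_sets)
  qed (use BL_ball_abs_le[OF G(1)] G(2) in auto)
  have "BL_dist (M0_space w) (M_dist w) (law_on_M0 w (K X)) (law_on_M0 w Q) = (SUP F\<in>C. ?f F X)"
    if X: "X \<in> space M" for X
    unfolding BL_dist_def BL_ball_def[symmetric]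
  proof (rule antisym)
    show "(SUP F\<in>C. ?f F X) \<le> (SUP F\<in>BL_ball. ?f F X)"
      using C by (intro cSUP_subset_mono bdd X) auto
    show "(SUP F\<in>BL_ball. ?f F X) \<le> (SUP F\<in>C. ?f F X)"
    proof (rule cSUP_least)
      fix F assume F: "F \<in> BL_ball"
      then obtain G where G: "\<And>n::nat. G n \<in> C" "\<And>x. x \<in> M0_space w \<Longrightarrow> (\<lambda>n. G n x) \<longlonglongrightarrow> F x"
        using C(4) by metis
      have "(\<lambda>n. ?f (G n) X) \<longlonglongrightarrow> ?f F X"
        using G C(2) F by (intro tendsto_intros lim KX[OF X] Q) auto
      moreover have "?f (G n) X \<le> (SUP F\<in>C. ?f F X)" for n
        by (rule cSUP_upper[OF G(1) bdd[OF X C(2)]])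
      ultimately show "?f F X \<le> (SUP F\<in>C. ?f F X)"
        by (intro LIMSEQ_le_const2) auto
    qed (use zero_in_BL_ball in auto)
  qed
  moreover have "(\<lambda>X. SUP F\<in>C. ?f F X) \<in> borel_measurable M"
  proof (rule borel_measurable_cSUP)
    fix F assume "F \<in> C"
    then have F: "F \<in> BL_ball" using C by auto
    have "(\<lambda>X. \<integral>x. F (into_M0 x) \<partial>K X) \<in> borel_measurable M"
      using measurable_compose[OF measurable_prob_algebraD[OF K]
          integral_measurable_subprob_algebra[OF measurable_BL_ball_into_M0[OF F]]] .
    then have "(\<lambda>X. \<integral>x. F x \<partial>law_on_M0 w (K X)) \<in> borel_measurable M"
      by (rule measurable_cong[THEN iffD1, rotated]) (simp add: integral_law_on_M0[OF F KX(2)])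
    then show "?f F \<in> borel_measurable M" by measurable
  qed (use C bdd in auto)
  ultimately show ?thesis by (simp cong: measurable_cong)
qed

end

section \<open>The Bernstein--von Mises theorem\<close>

text \<open>Common setting of both choices of scales and weights, which enter through
  \<open>growth\<close>, positivity and \<open>s_le_1\<close>; the truth enters through
  \<open>f\<^sub>0_le\<close>.\<close>

locale white_noise_bvm = bounded_unimodal h H + weights w
  for h :: "real \<Rightarrow> real" and H :: real and w :: "nat \<Rightarrow> real" +
  fixes s :: "nat \<Rightarrow> real" and f\<^sub>0 :: "nat \<times> nat \<Rightarrow> real" and c \<kappa> L :: real
  assumes s_pos: "s l > 0" and s_le_1: "s l \<le> 1"
    and c_pos: "c > 0" and \<kappa>_nonneg: "\<kappa> \<ge> 0" and L_pos: "L > 0"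
    and tail: "x \<ge> 0 \<Longrightarrow> ln (1 / h x) \<le> c * (1 + ln (1 + x) powr (1 + \<kappa>))"
    and f\<^sub>0_le: "i \<in> wavelet_idx \<Longrightarrow> \<bar>f\<^sub>0 i\<bar> \<le> L"
    and growth: "(\<lambda>l. (real l + ln (1 / s l)) powr (1 + \<kappa>) / (w l)\<^sup>2) \<longlonglongrightarrow> 0"
begin

abbreviation r :: "nat \<Rightarrow> real" where
  "r l \<equiv> real l + ln (1 / s l)"

lemma r_ge: "real l \<le> r l"
  using s_pos[of l] s_le_1[of l] by simp

abbreviation post_law :: "nat \<Rightarrow> (nat \<times> nat \<Rightarrow> real) \<Rightarrow> nat \<times> nat \<Rightarrow> real measure" where
  "post_law n X i \<equiv> density lborel (post_density n (s (fst i)) (X i))"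

lemma weighted_laws_noise: "weighted_laws w (\<lambda>_. density lborel std_normal_density)"
  by (simp add: weighted_laws_def weights_axioms noise.coordinate_laws_axioms)

lemma weighted_laws_post: "n > 0 \<Longrightarrow> weighted_laws w (post_law n X)"
  by (simp add: weighted_laws_def weights_axioms coordinate_laws_def prob_space_post_density s_pos)

lemma rescaled_posterior_eq:
  assumes "n > 0"
  shows "rescaled_posterior n h s X = PiM wavelet_idx (post_law n X)"
proof -
  have sets: "sets (coord_posterior n h (s (fst i)) (X i)) = sets borel" for i
    by (simp add: coord_posterior_def coord_prior_def)
  have distr: "distr (coord_posterior n h (s (fst i)) (X i)) borel (\<lambda>\<theta>. sqrt (real n) * (\<theta> - X i)) = post_law n X i" for i
    using assms s_pos by (rule coord_posterior_rescaled)
  have meas: "(\<lambda>\<theta>. sqrt (real n) * (\<theta> - X i)) \<in> coord_posterior n h (s (fst i)) (X i) \<rightarrow>\<^sub>M borel" for i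
    unfolding measurable_cong_sets[OF sets refl] by measurable
  \<comment> \<open>That the posterior factor has mass 1 is read off from its image, already known
    to be a probability measure.\<close>
  have prob: "prob_space (coord_posterior n h (s (fst i)) (X i))" for i
    by (rule prob_space_distrD[OF meas]) (simp add: distr prob_space_post_density assms s_pos)
  show ?thesis
    unfolding rescaled_posterior_def posterior_def rescale_def
    by (subst distr_PiM_coordinatewise[OF prob meas]) (simp add: distr)
qed

text \<open>The constant of \<open>post_density_tail\<close> times \<open>exp c\<close>, which stems
  from the additive constant in \<open>tail\<close>.\<close>

definition tail_const :: real where
  "tail_const = H / std_normal_density 1 * exp c"

lemma tail_const_nonneg: "tail_const \<ge> 0"
  using H_pos normal_density_pos[of 1 0 1] by (simp add: tail_const_def less_imp_le)

text \<open>With \<open>y\<close> the argument of \<open>h\<close>, \<open>1 + y\<close> is at most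
  \<open>(3 + L + l) / s l\<close>, so its logarithm is at most a constant multiple of
  \<open>r l\<close>. The tail condition turns this into a bound on \<open>1 / h\<close>.\<close>

lemma inverse_h_le:
  assumes l: "l \<ge> 1" and x: "\<bar>x\<bar> \<le> L + real l + 1"
  shows "1 / h ((\<bar>x\<bar> + 1) / s l) \<le> exp (c + c * (3 + L) powr (1 + \<kappa>) * r l powr (1 + \<kappa>))"
proof -
  let ?y = "(\<bar>x\<bar> + 1) / s l"
  have s: "0 < s l" "s l \<le> 1" by (rule s_pos s_le_1)+
  have y: "?y \<ge> 0" using s by simp
  have "?y \<le> (L + real l + 2) / s l" using s x by (intro divide_right_mono) auto
  moreover have "1 \<le> 1 / s l" using s by simp
  moreover have "1 / s l + (L + real l + 2) / s l = (3 + L + real l) / s l"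
    by (simp flip: add_divide_distrib)
  ultimately have "1 + ?y \<le> (3 + L + real l) / s l" by linarith
  then have "ln (1 + ?y) \<le> ln ((3 + L + real l) * (1 / s l))"
    using y L_pos s by (subst ln_le_cancel_iff) (auto intro!: add_pos_nonneg)
  also have "\<dots> = ln (3 + L + real l) + ln (1 / s l)"
    using L_pos s by (intro ln_mult_pos) auto
  also have "ln (3 + L + real l) \<le> 2 + L + real l"
    using ln_le_minus_one[of "3 + L + real l"] L_pos by simp
  \<comment> \<open>Constants are absorbed through \<open>l \<ge> 1\<close>, which gives
    \<open>2 + L \<le> (2 + L) * l\<close>.\<close>
  also have "2 + L + real l + ln (1 / s l) \<le> (3 + L) * r l"
  proof -
    have "2 + L \<le> (2 + L) * real l" "0 \<le> (2 + L) * ln (1 / s l)"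
      using l L_pos s by auto
    then show ?thesis by (simp add: algebra_simps)
  qed
  finally have "ln (1 + ?y) powr (1 + \<kappa>) \<le> ((3 + L) * r l) powr (1 + \<kappa>)"
    using y \<kappa>_nonneg by (intro powr_mono2) auto
  also have "\<dots> = (3 + L) powr (1 + \<kappa>) * r l powr (1 + \<kappa>)"
    by (rule powr_mult)
  finally have "c * (1 + ln (1 + ?y) powr (1 + \<kappa>)) \<le> c + c * (3 + L) powr (1 + \<kappa>) * r l powr (1 + \<kappa>)"
    using c_pos by (simp add: algebra_simps)
  with tail[OF y] have "ln (1 / h ?y) \<le> c + c * (3 + L) powr (1 + \<kappa>) * r l powr (1 + \<kappa>)"
    by linarith
  then have "exp (ln (1 / h ?y)) \<le> exp (c + c * (3 + L) powr (1 + \<kappa>) * r l powr (1 + \<kappa>))"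
    by simp
  then show ?thesis using pos[of ?y] by simp
qed

text \<open>A majorant free of \<open>n\<close> and of the data. It serves Borel--Cantelli and
  yields a truncation level common to all \<open>n\<close>.\<close>

definition level_bound :: "real \<Rightarrow> nat \<Rightarrow> real" where
  "level_bound \<delta> l = 2 ^ l * (tail_const *
     exp (c * (3 + L) powr (1 + \<kappa>) * r l powr (1 + \<kappa>) - \<delta>\<^sup>2 / 4 * (w l)\<^sup>2))"

lemma level_bound_nonneg: "level_bound \<delta> l \<ge> 0"
  using tail_const_nonneg by (simp add: level_bound_def)

lemma summable_level_bound_post: "\<delta> > 0 \<Longrightarrow> summable (level_bound \<delta>)"
  unfolding level_bound_def
  using w_pos r_ge \<kappa>_nonneg growth c_pos tail_const_nonneg
  by (intro summable_level_bound) auto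

text \<open>The Gaussian factor of \<open>post_density_tail\<close> at
  \<open>M = \<delta> * w l\<close> competes with the growth of \<open>1 / h\<close> from
  \<open>inverse_h_le\<close>, for which the linear bound on the data is assumed.\<close>

lemma post_level_tail_le:
  assumes n: "n > 0" and l: "l \<ge> 1" and X: "level_max X l \<le> L + real l + 1" and "\<delta> > 0"
  shows "coordinate_laws.level_tail (post_law n X) l (\<delta> * w l) \<le> level_bound \<delta> l"
proof -
  interpret weighted_laws w "post_law n X" using n by (rule weighted_laws_post)
  let ?a = "H / std_normal_density 1 * exp (- (\<delta> * w l)\<^sup>2 / 4)"
  have a: "?a \<ge> 0" using H_pos normal_density_pos[of 1 0 1] by (simp add: less_imp_le)
  have "measure (post_law n X (l, k)) {u. \<delta> * w l < \<bar>u\<bar>}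
      \<le> tail_const * exp (c * (3 + L) powr (1 + \<kappa>) * r l powr (1 + \<kappa>) - \<delta>\<^sup>2 / 4 * (w l)\<^sup>2)"
    if "k < 2 ^ l" for k
  proof -
    have "measure (post_law n X (l, k)) {u. \<delta> * w l < \<bar>u\<bar>} \<le> ?a / h ((\<bar>X (l, k)\<bar> + 1) / s l)"
      using post_density_tail[of n "s l" "\<delta> * w l" "X (l, k)"] n s_pos \<open>\<delta> > 0\<close> w_pos[of l] by simp
    also have "\<dots> = ?a * (1 / h ((\<bar>X (l, k)\<bar> + 1) / s l))" by simp
    also have "\<dots> \<le> ?a * exp (c + c * (3 + L) powr (1 + \<kappa>) * r l powr (1 + \<kappa>))"
      using level_max_ge[OF that, of X] X a by (intro mult_left_mono inverse_h_le l) auto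
    also have "\<dots> = tail_const * exp (c * (3 + L) powr (1 + \<kappa>) * r l powr (1 + \<kappa>) - \<delta>\<^sup>2 / 4 * (w l)\<^sup>2)"
    proof -
      have "exp (- (\<delta> * w l)\<^sup>2 / 4) * exp (c + c * (3 + L) powr (1 + \<kappa>) * r l powr (1 + \<kappa>))
          = exp c * exp (c * (3 + L) powr (1 + \<kappa>) * r l powr (1 + \<kappa>) - \<delta>\<^sup>2 / 4 * (w l)\<^sup>2)"
        unfolding exp_add[symmetric] by (simp add: power_mult_distrib)
      then show ?thesis by (simp only: tail_const_def mult.assoc)
    qed
    finally show ?thesis .
  qed
  then have "level_tail l (\<delta> * w l) \<le> (\<Sum>k<(2::nat) ^ l.
      tail_const * exp (c * (3 + L) powr (1 + \<kappa>) * r l powr (1 + \<kappa>) - \<delta>\<^sup>2 / 4 * (w l)\<^sup>2))"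
    unfolding level_tail_def by (intro sum_mono) auto
  then show ?thesis by (simp add: level_bound_def)
qed

lemma AE_posterior_in_M0:
  assumes n: "n > 0" and X: "\<And>l. l \<ge> N \<Longrightarrow> level_max X l \<le> L + real l + 1"
  shows "AE x in PiM wavelet_idx (post_law n X). x \<in> M0_space w"
proof -
  interpret weighted_laws w "post_law n X" using n by (rule weighted_laws_post)
  show ?thesis
  proof (rule AE_in_M0)
    fix \<delta> :: real assume "\<delta> > 0"
    show "summable (\<lambda>l. level_tail l (\<delta> * w l))"
    proof (rule summable_comparison_test'[OF summable_level_bound_post[OF \<open>\<delta> > 0\<close>]])
      fix l assume "l \<ge> max N 1"
      then show "norm (level_tail l (\<delta> * w l)) \<le> level_bound \<delta> l"
        using post_level_tail_le[OF n _ X \<open>\<delta> > 0\<close>, of l] level_tail_nonneg[of l "\<delta> * w l"] by simp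
    qed
  qed
qed

text \<open>The noise is shrunk by \<open>1 / sqrt n \<le> 1\<close>, so one bound on the noise
  controls the data of all \<open>n\<close> at once.\<close>

lemma level_max_shift_noise_le:
  assumes "n > 0" "level_max z l \<le> real l + 1"
  shows "level_max (shift_noise n f\<^sub>0 z) l \<le> L + real l + 1"
proof (rule level_max_leI)
  fix k :: nat assume k: "k < 2 ^ l"
  have "\<bar>1 / sqrt (real n) * z (l, k)\<bar> \<le> 1 * \<bar>z (l, k)\<bar>"
    unfolding abs_mult using assms(1) by (intro mult_right_mono) auto
  moreover have "\<bar>z (l, k)\<bar> \<le> real l + 1" using level_max_ge[OF k, of z] assms(2) by simp
  moreover have "\<bar>f\<^sub>0 (l, k)\<bar> \<le> L" using k by (intro f\<^sub>0_le) simp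
  ultimately show "\<bar>shift_noise n f\<^sub>0 z (l, k)\<bar> \<le> L + real l + 1"
    using k abs_triangle_ineq[of "f\<^sub>0 (l, k)" "1 / sqrt (real n) * z (l, k)"]
    unfolding shift_noise_def by simp
qed

lemma AE_data_law_le:
  assumes n: "n > 0"
  shows "AE X in data_law n f\<^sub>0. \<exists>N. \<forall>l\<ge>N. level_max X l \<le> L + real l + 1"
proof -
  note measurable_level_max [measurable] measurable_coeff [measurable]
  have "AE z in white_noise. \<exists>N. \<forall>l\<ge>N. level_max (shift_noise n f\<^sub>0 z) l \<le> L + real l + 1"
    using AE_white_noise_le_linear by eventually_elim (use level_max_shift_noise_le[OF n] in blast)
  moreover have "{X\<in>space coeff_space. \<exists>N. \<forall>l\<ge>N. level_max X l \<le> L + real l + 1} \<in> sets coeff_space"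
    by measurable
  moreover have "shift_noise n f\<^sub>0 \<in> white_noise \<rightarrow>\<^sub>M coeff_space"
    using measurable_shift_noise by (simp cong: measurable_cong_sets add: measurable_cong_sets[OF sets_white_noise refl])
  ultimately show ?thesis
    unfolding data_law_eq_distr[OF n] by (subst AE_distr_iff) auto
qed

section \<open>The expected distance to white noise\<close>

abbreviation bvm_dist :: "nat \<Rightarrow> (nat \<times> nat \<Rightarrow> real) \<Rightarrow> real" where
  "bvm_dist n X \<equiv> BL_dist (M0_space w) (M_dist w)
     (law_on_M0 w (rescaled_posterior n h s X)) (law_on_M0 w white_noise)"

lemma prob_space_white_noise: "prob_space white_noise"
  unfolding white_noise_def by (rule noise.P.prob_space_axioms)

lemma prob_space_data_law: "n > 0 \<Longrightarrow> prob_space (data_law n f\<^sub>0)"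
  unfolding data_law_def by (intro prob_space_PiM prob_space_normal_density) simp

lemma bvm_dist_bounds: 
  assumes "n > 0"
  shows "bvm_dist n X \<in> {0..2}"
proof -
  interpret weighted_laws w "post_law n X" using assms by (rule weighted_laws_post)
  show ?thesis
    unfolding rescaled_posterior_eq[OF assms]
    by (intro BL_dist_bounds P.prob_space_axioms sets_PiM_R prob_space_white_noise sets_white_noise)
qed

lemma measurable_bvm_dist:
  assumes "n > 0"
  shows "bvm_dist n \<in> borel_measurable coeff_space"
  unfolding rescaled_posterior_eq[OF assms]
  using assms s_pos
  by (intro measurable_BL_dist measurable_PiM_density prob_space_post_density
      measurable_post_density prob_space_white_noise sets_white_noise) auto

lemma well_posed: "BvM_well_posed h s w f\<^sub>0"
  unfolding BvM_well_posed_def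
proof (intro conjI allI impI)
  show "AE x in white_noise. x \<in> M0_space w"
    using w_pos r_ge \<kappa>_nonneg growth by (intro AE_white_noise_in_M0[where r = r and p = "1 + \<kappa>"]) auto
next
  fix n :: nat assume "n \<ge> 1"
  then have n: "n > 0" by simp
  show "AE X in data_law n f\<^sub>0. AE x in rescaled_posterior n h s X. x \<in> M0_space w"
    using AE_data_law_le[OF n]
  proof eventually_elim
    case (elim X)
    then obtain N where "\<And>l. l \<ge> N \<Longrightarrow> level_max X l \<le> L + real l + 1" by auto
    then show ?case unfolding rescaled_posterior_eq[OF n] by (rule AE_posterior_in_M0[OF n])
  qed
  interpret D: prob_space "data_law n f\<^sub>0" using n by (rule prob_space_data_law)
  have "sets (data_law n f\<^sub>0) = sets coeff_space"
    unfolding data_law_def by (rule sets_PiM_cong) auto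
  then show "integrable (data_law n f\<^sub>0) (bvm_dist n)"
    using bvm_dist_bounds[OF n] measurable_bvm_dist[OF n]
    by (intro D.integrable_const_bound[where B = 2]) (auto cong: measurable_cong_sets)
qed

text \<open>With the noise fixed, \<open>\<delta>\<close> and then the level \<open>J\<close> are
  chosen from bounds free of \<open>n\<close>; below \<open>J\<close> there are finitely many
  coordinates, each converging in L1 as \<open>n\<close> grows.\<close>

lemma bvm_dist_tendsto_0:
  assumes lim: "\<And>i. i \<in> wavelet_idx \<Longrightarrow> \<exists>v>0. (h \<longlongrightarrow> v) (at (f\<^sub>0 i / s (fst i)))"
    and z: "\<And>l. l \<ge> N \<Longrightarrow> level_max z l \<le> real l + 1"
  shows "(\<lambda>n. bvm_dist (Suc n) (shift_noise (Suc n) f\<^sub>0 z)) \<longlonglongrightarrow> 0"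
proof (rule tendstoI)
  fix e :: real assume e: "e > 0"
  \<comment> \<open>Error budget: \<open>2 * \<delta>\<close> is \<open>e / 4\<close>, four times
    the series tail is below \<open>e / 4\<close>, and so is the sum of the L1 distances.\<close>
  define \<delta> where "\<delta> = e / 8"
  have \<delta>: "\<delta> > 0" using e by (simp add: \<delta>_def)
  define X where "X = (\<lambda>n. shift_noise (Suc n) f\<^sub>0 z)"
  define B where "B = (\<lambda>l. level_bound \<delta> l + noise.level_tail l (\<delta> * w l))"
  have noise: "summable (\<lambda>l. noise.level_tail l (\<delta> * w l))"
    using w_pos r_ge \<kappa>_nonneg growth \<delta> by (intro noise_tail_summable[where r = r and p = "1 + \<kappa>"]) auto
  have B: "summable B"
    unfolding B_def by (intro summable_add summable_level_bound_post \<delta> noise)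
  have "(\<lambda>J. \<Sum>l. B (l + J)) \<longlonglongrightarrow> 0" by (rule suminf_exist_split2[OF B])
  then have "\<forall>\<^sub>F J in sequentially. (\<Sum>l. B (l + J)) < e / 16"
    using e by (intro order_tendstoD) auto
  \<comment> \<open>From \<open>N\<close> on the noise bound holds, and 1 is the first level covered
    by \<open>inverse_h_le\<close>.\<close>
  then have "\<forall>\<^sub>F J in sequentially. (\<Sum>l. B (l + J)) < e / 16 \<and> J \<ge> max N 1"
    using eventually_ge_at_top by (rule eventually_conj)
  then obtain J where J: "(\<Sum>l. B (l + J)) < e / 16" "J \<ge> N" "J \<ge> 1"
    by (auto simp: eventually_sequentially)
  define tv where "tv = (\<lambda>n i. \<integral>u. \<bar>post_density (Suc n) (s (fst i)) (X n i) u - std_normal_density u\<bar> \<partial>lborel)"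
  have "(\<lambda>n. tv n i) \<longlonglongrightarrow> 0" if "i \<in> low_idx J" for i
  proof -
    have i: "i \<in> wavelet_idx" using that low_idx_subset by auto
    from lim[OF this] obtain v where "v > 0" "(h \<longlongrightarrow> v) (at (f\<^sub>0 i / s (fst i)))" by auto
    from post_density_tendsto[OF s_pos this, of "z i"] show ?thesis
      using i by (simp add: tv_def X_def shift_noise_def)
  qed
  then have "(\<lambda>n. \<Sum>i\<in>low_idx J. tv n i) \<longlonglongrightarrow> (\<Sum>i\<in>low_idx J. 0)"
    by (rule tendsto_sum)
  then have "\<forall>\<^sub>F n in sequentially. (\<Sum>i\<in>low_idx J. tv n i) < e / 4"
    using e by (intro order_tendstoD) auto
  then show "\<forall>\<^sub>F n in sequentially. dist (bvm_dist (Suc n) (shift_noise (Suc n) f\<^sub>0 z)) 0 < e"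
  proof eventually_elim
    case (elim n)
    have X: "level_max (X n) l \<le> L + real l + 1" if "l \<ge> N" for l
      unfolding X_def using z[OF that] by (intro level_max_shift_noise_le) auto
    have "bvm_dist (Suc n) (X n) \<le> 2 * \<delta> + 4 * (\<Sum>l. B (l + J)) + (\<Sum>i\<in>low_idx J. tv n i)"
      unfolding rescaled_posterior_eq[OF zero_less_Suc] white_noise_def tv_def
    proof (rule BL_dist_PiM_density_le)
      show "AE x in PiM wavelet_idx (post_law (Suc n) (X n)). x \<in> M0_space w"
        by (rule AE_posterior_in_M0[OF _ X]) auto
      show "AE x in (\<Pi>\<^sub>M i\<in>wavelet_idx. density lborel std_normal_density). x \<in> M0_space w"
        using well_posed unfolding BvM_well_posed_def white_noise_def by blast
      show "coordinate_laws.level_tail (post_law (Suc n) (X n)) l (\<delta> * w l) \<le> B l" if "l \<ge> J" for l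
      proof -
        have "coordinate_laws.level_tail (post_law (Suc n) (X n)) l (\<delta> * w l) \<le> level_bound \<delta> l"
          using that J by (intro post_level_tail_le X \<delta>) auto
        then show ?thesis using noise.level_tail_nonneg[of l "\<delta> * w l"] by (simp add: B_def)
      qed
      show "noise.level_tail l (\<delta> * w l) \<le> B l" for l
        using level_bound_nonneg[of \<delta> l] by (simp add: B_def)
    qed (auto simp: weighted_laws_post weighted_laws_noise integrable_post_density post_density_nonneg s_pos \<delta> B)
    then have "bvm_dist (Suc n) (X n) < e" using J(1) elim e by (simp add: \<delta>_def)
    then show ?case using bvm_dist_bounds[of "Suc n" "X n"] by (simp add: X_def dist_real_def)
  qed
qed

text \<open>Through \<open>shift_noise\<close> the expectations become integrals over one
  probability space, on which the distance is at most 2 and tends to 0 almost surely.\<close>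

lemma expected_bvm_dist_tendsto_0:
  assumes lim: "\<And>i. i \<in> wavelet_idx \<Longrightarrow> \<exists>v>0. (h \<longlongrightarrow> v) (at (f\<^sub>0 i / s (fst i)))"
  shows "(\<lambda>n. \<integral>X. bvm_dist n X \<partial>data_law n f\<^sub>0) \<longlonglongrightarrow> 0"
\<comment> \<open>The shift of index discards \<open>n = 0\<close>, where \<open>1 / sqrt n\<close>
  does not describe a noise level.\<close>
proof (rule iffD1[OF filterlim_sequentially_Suc])
  interpret W: prob_space white_noise by (rule prob_space_white_noise)
  have shift: "shift_noise n f\<^sub>0 \<in> white_noise \<rightarrow>\<^sub>M coeff_space" for n
    unfolding measurable_cong_sets[OF sets_white_noise refl] by (rule measurable_shift_noise)
  have "(\<integral>X. bvm_dist (Suc n) X \<partial>data_law (Suc n) f\<^sub>0)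
      = (\<integral>z. bvm_dist (Suc n) (shift_noise (Suc n) f\<^sub>0 z) \<partial>white_noise)" for n
    unfolding data_law_eq_distr[OF zero_less_Suc] by (intro integral_distr shift measurable_bvm_dist) simp
  moreover have "(\<lambda>n. \<integral>z. bvm_dist (Suc n) (shift_noise (Suc n) f\<^sub>0 z) \<partial>white_noise) \<longlonglongrightarrow> (\<integral>z. 0 \<partial>white_noise)"
  proof (rule integral_dominated_convergence[where w = "\<lambda>_. 2"])
    show "AE z in white_noise. (\<lambda>n. bvm_dist (Suc n) (shift_noise (Suc n) f\<^sub>0 z)) \<longlonglongrightarrow> 0"
      using AE_white_noise_le_linear
      by eventually_elim (use bvm_dist_tendsto_0[OF lim] in blast)
    show "(\<lambda>z. bvm_dist (Suc n) (shift_noise (Suc n) f\<^sub>0 z)) \<in> borel_measurable white_noise" for n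
      by (rule measurable_compose[OF shift measurable_bvm_dist]) simp
    show "AE z in white_noise. norm (bvm_dist (Suc n) (shift_noise (Suc n) f\<^sub>0 z)) \<le> 2" for n
      using bvm_dist_bounds[of "Suc n"] by (intro AE_I2) simp
  qed auto
  ultimately show "(\<lambda>n. \<integral>X. bvm_dist (Suc n) X \<partial>data_law (Suc n) f\<^sub>0) \<longlonglongrightarrow> 0" by simp
qed

lemma expected_bvm_dist_tendsto_0_cont:
  assumes "cont_at_truth h s f\<^sub>0"
  shows "(\<lambda>n. \<integral>X. bvm_dist n X \<partial>data_law n f\<^sub>0) \<longlonglongrightarrow> 0"
proof (rule expected_bvm_dist_tendsto_0)
  fix i assume i: "i \<in> wavelet_idx"
  show "\<exists>v>0. (h \<longlongrightarrow> v) (at (f\<^sub>0 i / s (fst i)))"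
  \<comment> \<open>A zero coefficient leads to the point 0, where unimodality and symmetry give the
    limit; elsewhere continuity and positivity of \<open>h\<close> do.\<close>
  proof (cases "f\<^sub>0 i = 0")
    case True
    then show ?thesis using has_limit_at_0 by simp
  next
    case False
    then have "isCont h (f\<^sub>0 i / s (fst i))"
      using assms i unfolding cont_at_truth_def by (cases i) auto
    then show ?thesis using pos unfolding isCont_def by blast
  qed
qed

end

section \<open>Growth condition for the two choices of scales and weights\<close>

lemma growth_powr:
  fixes r :: "nat \<Rightarrow> real"
  assumes r: "\<And>l. l \<ge> 1 \<Longrightarrow> 0 \<le> r l \<and> r l \<le> a * real l powr p" and "a > 0" and \<kappa>: "\<kappa> \<ge> 0" and q: "p * (1 + \<kappa>) < 2 * q"
  shows "(\<lambda>l. r l powr (1 + \<kappa>) / (if l = 0 then 1 else real l powr q)\<^sup>2) \<longlonglongrightarrow> 0"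
proof (rule Lim_null_comparison)
  \<comment> \<open>The margin between the exponents of the denominator and the numerator; the ratio
    is at most a multiple of \<open>l powr (- d)\<close>.\<close>
  define d where "d = 2 * q - p * (1 + \<kappa>)"
  have "d > 0" using q by (simp add: d_def)
  then have "(\<lambda>l. real l powr (- d)) \<longlonglongrightarrow> 0"
    by (intro tendsto_neg_powr filterlim_real_sequentially) auto
  then show "(\<lambda>l. a powr (1 + \<kappa>) * real l powr (- d)) \<longlonglongrightarrow> 0"
    by (rule tendsto_mult_right_zero)
  show "\<forall>\<^sub>F l in sequentially. norm (r l powr (1 + \<kappa>) / (if l = 0 then 1 else real l powr q)\<^sup>2)
      \<le> a powr (1 + \<kappa>) * real l powr (- d)"
    using eventually_ge_at_top[of 1]
  proof eventually_elim
    case (elim l)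
    have "r l powr (1 + \<kappa>) \<le> (a * real l powr p) powr (1 + \<kappa>)"
      using r[OF elim] \<kappa> by (intro powr_mono2) auto
    also have "\<dots> = a powr (1 + \<kappa>) * real l powr (p * (1 + \<kappa>))"
      using \<open>a > 0\<close> by (simp add: powr_mult powr_powr)
    finally have "r l powr (1 + \<kappa>) / real l powr (2 * q) \<le> a powr (1 + \<kappa>) * real l powr (p * (1 + \<kappa>)) / real l powr (2 * q)"
      by (intro divide_right_mono) auto
    also have "\<dots> = a powr (1 + \<kappa>) * real l powr (- d)"
      using elim by (simp add: d_def powr_diff)
    finally show ?case using elim by (simp add: power2_eq_square flip: powr_add)
  qed
qed

theorem theorem5:
  fixes h :: "real \<Rightarrow> real" and f\<^sub>0 :: "nat \<times> nat \<Rightarrow> real"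
    and c\<^sub>1 \<kappa> \<beta> L :: real
  assumes h_density: "h \<in> borel_measurable borel" "integrable lborel h" "(\<integral>x. h x \<partial>lborel) = 1"
    and h_symmetric: "\<And>x. h (- x) = h x"
    and h_positive: "\<And>x. h x > 0"
    and h_bounded: "bounded (range h)"
    and h_decreasing: "antimono_on {0..} h"
    and c\<^sub>1: "c\<^sub>1 > 0" and \<kappa>: "\<kappa> \<ge> 0"
    and h_tail: "\<And>x. x \<ge> 0 \<Longrightarrow> ln (1 / h x) \<le> c\<^sub>1 * (1 + ln (1 + x) powr (1 + \<kappa>))"
    and \<beta>: "\<beta> > 0" and L: "L > 0"
    and f\<^sub>0: "f\<^sub>0 \<in> holder_ball \<beta> L"
  shows
    "(\<forall>\<epsilon>>0. let s = (\<lambda>l. 2 powr (- (real l)\<^sup>2));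
                w = (\<lambda>l. if l = 0 then 1 else real l powr (1 + \<kappa> + \<epsilon>))
            in BvM_well_posed h s w f\<^sub>0 \<and>
               (cont_at_truth h s f\<^sub>0 \<longrightarrow> (\<lambda>n. \<integral>X. BL_dist (M0_space w) (M_dist w)
                         (law_on_M0 w (rescaled_posterior n h s X)) (law_on_M0 w white_noise)
                       \<partial>data_law n f\<^sub>0) \<longlonglongrightarrow> 0)) \<and>
     (\<forall>\<alpha>>0. \<forall>\<epsilon>>0. let s = (\<lambda>l. 2 powr (- real l * (1/2 + \<alpha>)));
                w = (\<lambda>l. if l = 0 then 1 else real l powr ((1 + \<kappa> + \<epsilon>) / 2))
            in BvM_well_posed h s w f\<^sub>0 \<and>
               (cont_at_truth h s f\<^sub>0 \<longrightarrow> (\<lambda>n. \<integral>X. BL_dist (M0_space w) (M_dist w)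
                         (law_on_M0 w (rescaled_posterior n h s X)) (law_on_M0 w white_noise)
                       \<partial>data_law n f\<^sub>0) \<longlonglongrightarrow> 0))"
proof -
  obtain H where H: "\<And>x. h x \<le> H"
    using h_bounded unfolding bounded_iff by (metis abs_le_D1 rangeI real_norm_def)
  have f\<^sub>0_le: "\<bar>f\<^sub>0 i\<bar> \<le> L" if i: "i \<in> wavelet_idx" for i
  proof -
    obtain l k where lk: "i = (l, k)" "k < 2 ^ l" using i by (cases i) auto
    have "\<bar>f\<^sub>0 (l, k)\<bar> \<le> 2 powr (- real l * (1/2 + \<beta>)) * L"
      using level_max_ge[OF lk(2), of f\<^sub>0] f\<^sub>0 unfolding holder_ball_def by (blast intro: order_trans)
    also have "\<dots> \<le> 1 * L"
      using L \<beta> powr_mono[of "- real l * (1/2 + \<beta>)" 0 2] by (intro mult_right_mono) auto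
    finally show ?thesis using lk by simp
  qed
  \<comment> \<open>The scales are summarised by a power \<open>p\<close> that bounds
    \<open>l + ln (1 / s l)\<close>, the weights by \<open>q\<close>; the strict inequality between
    \<open>p\<close> and \<open>q\<close> yields the growth condition.\<close>
  have bvm: "BvM_well_posed h s w f\<^sub>0 \<and>
      (cont_at_truth h s f\<^sub>0 \<longrightarrow> (\<lambda>n. \<integral>X. BL_dist (M0_space w) (M_dist w)
         (law_on_M0 w (rescaled_posterior n h s X)) (law_on_M0 w white_noise) \<partial>data_law n f\<^sub>0) \<longlonglongrightarrow> 0)"
    if s: "\<And>l. 0 < s l" "\<And>l. s l \<le> 1" and w: "w = (\<lambda>l. if l = 0 then 1 else real l powr q)"
      and a: "a > 0" "\<And>l. l \<ge> 1 \<Longrightarrow> real l + ln (1 / s l) \<le> a * real l powr p"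
      and q: "p * (1 + \<kappa>) < 2 * q" for s w q a p
  proof -
    have "0 \<le> real l + ln (1 / s l)" for l
      using s[of l] by (intro add_nonneg_nonneg) auto
    then have "(\<lambda>l. (real l + ln (1 / s l)) powr (1 + \<kappa>) / (w l)\<^sup>2) \<longlonglongrightarrow> 0"
      unfolding w using a q \<kappa> by (intro growth_powr[where a = a and p = p]) auto
    then interpret white_noise_bvm h H w s f\<^sub>0 c\<^sub>1 \<kappa> L
      using h_density h_symmetric h_positive H h_decreasing c\<^sub>1 \<kappa> L h_tail f\<^sub>0_le s
      by unfold_locales (auto simp: w monotone_on_def)
    show ?thesis using well_posed expected_bvm_dist_tendsto_0_cont by blast
  qed
  have ln2: "ln (2::real) \<le> 1" using ln_le_minus_one[of "2::real"] by simp
  show ?thesis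
    unfolding Let_def
  proof (rule conjI; intro allI impI)
    fix \<epsilon> :: real assume \<epsilon>: "\<epsilon> > 0"
    show "BvM_well_posed h (\<lambda>l. 2 powr (- (real l)\<^sup>2)) (\<lambda>l. if l = 0 then 1 else real l powr (1 + \<kappa> + \<epsilon>)) f\<^sub>0 \<and>
      (cont_at_truth h (\<lambda>l. 2 powr (- (real l)\<^sup>2)) f\<^sub>0 \<longrightarrow>
        (\<lambda>n. \<integral>X. BL_dist (M0_space (\<lambda>l. if l = 0 then 1 else real l powr (1 + \<kappa> + \<epsilon>)))
             (M_dist (\<lambda>l. if l = 0 then 1 else real l powr (1 + \<kappa> + \<epsilon>)))
             (law_on_M0 (\<lambda>l. if l = 0 then 1 else real l powr (1 + \<kappa> + \<epsilon>))
               (rescaled_posterior n h (\<lambda>l. 2 powr (- (real l)\<^sup>2)) X))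
             (law_on_M0 (\<lambda>l. if l = 0 then 1 else real l powr (1 + \<kappa> + \<epsilon>)) white_noise)
           \<partial>data_law n f\<^sub>0) \<longlonglongrightarrow> 0)"
    \<comment> \<open>Here \<open>ln (1 / s l)\<close> is \<open>l^2 * ln 2\<close>, so
      \<open>p = 2\<close>; as \<open>l \<le> l^2\<close> and \<open>ln 2 \<le> 1\<close>, the
      constant 2 suffices. The exponents compare as
      \<open>2 * (1 + \<kappa>) < 2 * (1 + \<kappa> + \<epsilon>)\<close>.\<close>
    proof (rule bvm[where a = 2 and p = 2 and q = "1 + \<kappa> + \<epsilon>"])
      fix l :: nat assume l: "l \<ge> 1"
      have "real l * 1 \<le> real l * real l" using l by (intro mult_left_mono) auto
      then have "real l \<le> (real l)\<^sup>2" by (simp add: power2_eq_square)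
      moreover have "(real l)\<^sup>2 * ln 2 \<le> (real l)\<^sup>2 * 1" using ln2 by (intro mult_left_mono) auto
      moreover have "ln (1 / 2 powr (- (real l)\<^sup>2)) = (real l)\<^sup>2 * ln 2" by (simp add: ln_div ln_powr)
      moreover have "real l powr 2 = (real l)\<^sup>2" using l by simp
      ultimately show "real l + ln (1 / 2 powr (- (real l)\<^sup>2)) \<le> 2 * real l powr 2" by linarith
    next
      show "2 powr (- (real l)\<^sup>2) \<le> 1" for l
        using powr_mono[of "- (real l)\<^sup>2" 0 2] by simp
    qed (use \<epsilon> \<kappa> in auto)
  next
    fix \<alpha> \<epsilon> :: real assume \<alpha>: "\<alpha> > 0" and \<epsilon>: "\<epsilon> > 0"
    show "BvM_well_posed h (\<lambda>l. 2 powr (- real l * (1/2 + \<alpha>))) (\<lambda>l. if l = 0 then 1 else real l powr ((1 + \<kappa> + \<epsilon>) / 2)) f\<^sub>0 \<and>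
      (cont_at_truth h (\<lambda>l. 2 powr (- real l * (1/2 + \<alpha>))) f\<^sub>0 \<longrightarrow>
        (\<lambda>n. \<integral>X. BL_dist (M0_space (\<lambda>l. if l = 0 then 1 else real l powr ((1 + \<kappa> + \<epsilon>) / 2)))
             (M_dist (\<lambda>l. if l = 0 then 1 else real l powr ((1 + \<kappa> + \<epsilon>) / 2)))
             (law_on_M0 (\<lambda>l. if l = 0 then 1 else real l powr ((1 + \<kappa> + \<epsilon>) / 2))
               (rescaled_posterior n h (\<lambda>l. 2 powr (- real l * (1/2 + \<alpha>))) X))
             (law_on_M0 (\<lambda>l. if l = 0 then 1 else real l powr ((1 + \<kappa> + \<epsilon>) / 2)) white_noise)
           \<partial>data_law n f\<^sub>0) \<longlonglongrightarrow> 0)"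
    \<comment> \<open>Now \<open>ln (1 / s l)\<close> is linear in \<open>l\<close>, so
      \<open>p = 1\<close>, and halving the exponent of the weights still leaves
      \<open>1 + \<kappa> < 1 + \<kappa> + \<epsilon>\<close>.\<close>
    proof (rule bvm[where a = "1 + (1/2 + \<alpha>)" and p = 1 and q = "(1 + \<kappa> + \<epsilon>) / 2"])
      fix l :: nat assume l: "l \<ge> 1"
      have "real l * (1/2 + \<alpha>) * ln 2 \<le> real l * (1/2 + \<alpha>) * 1"
        using ln2 \<alpha> by (intro mult_left_mono) auto
      then show "real l + ln (1 / 2 powr (- real l * (1/2 + \<alpha>))) \<le> (1 + (1/2 + \<alpha>)) * real l powr 1"
        using l by (simp add: ln_div ln_powr algebra_simps)
    next
      show "2 powr (- real l * (1/2 + \<alpha>)) \<le> 1" for l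
        using \<alpha> powr_mono[of "- real l * (1/2 + \<alpha>)" 0 2] by simp
    qed (use \<alpha> \<epsilon> \<kappa> in auto)
  qed
qed

end
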